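(* Let $q\in\mathbb{C}^n$ be non-zero and for $1\le\alpha\le n$ define $Q_\alpha:\mathbf{U}(n)\to\mathbb{C}$ by $$Q_\alpha(z)=\sum_{j=1}^n q_jz_{j\alpha}.$$ Then the collection $$\Omega=\{Q_\alpha/Q_\beta\mid 1\le\alpha,\beta\le n,\ \alpha\neq\beta\}$$ is an orthogonal harmonic family on the open subset $$W=\bigcap_{\alpha=1}^n\{z\in\mathbf{U}(n)\mid Q_\alpha(z)\neq0\}$$ of the unitary group $\mathbf{U}(n)$. The corresponding statement holds for the induced family (the restrictions to $W\cap\mathbf{SU}(n)$) on the special unitary group $\mathbf{SU}(n)$.
   Context: $\mathbf{U}(n)$ and $\mathbf{SU}(n)$ carry the Riemannian metrics induced from the left-invariant metric on $\mathbf{GL}_n(\mathbb{C})$ given on $\mathbb{C}^{n\times n}$ by $g(Z,W)=\mathrm{Re}\,\mathrm{trace}(ZW^* )$; $z_{j\alpha}$ are the matrix entries of $z$. For complex-valued functions, $\tau(f)=\mathrm{div}(\nabla f)$ (extended complex-linearly) and $\kappa(f,h)=g(\nabla f,\nabla h)$ with $g$ extended complex-bilinearly. A set $\Omega$ of complex-valued functions on a Riemannian manifold $M$ is an orthogonal harmonic family on $M$ if $\tau(\phi)=0$ and $\kappa(\phi,\psi)=0$ for all $\phi,\psi\in\Omega$. *)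

theory Defs
  imports "HOL-Analysis.Analysis"
begin

section \<open>Riemannian geometry of submanifolds of a Euclidean space\<close>

text \<open>
  A submanifold is given by its underlying set \<open>M\<close> in a Euclidean space, and a Riemannian metric on it
  by a function \<open>g\<close>, where \<open>g p v w\<close> only matters for \<open>p\<close> in \<open>M\<close> and \<open>v\<close>, \<open>w\<close> tangent to \<open>M\<close> at \<open>p\<close>.
  Functions and vector fields on \<open>M\<close> are total functions on the ambient space whose values outside \<open>M\<close>
  are irrelevant: all derivatives are taken within \<open>M\<close>. A function and its restriction to a
  submanifold are thus represented by the same term.
\<close>

definition tangent_space :: "'a::euclidean_space set \<Rightarrow> 'a \<Rightarrow> 'a set" where
  "tangent_space M p =
     {v. \<exists>\<gamma>::real \<Rightarrow> 'a. \<gamma> 0 = p \<and> (\<forall>\<^sub>F t in at 0. \<gamma> t \<in> M) \<and> (\<gamma> has_vector_derivative v) (at 0)}"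

text \<open>The Frechet derivative within \<open>M\<close> need not be unique as a linear map on the ambient space, but
  its values on tangent vectors of \<open>M\<close> are.\<close>

definition dir_deriv ::
  "'a::euclidean_space set \<Rightarrow> ('a \<Rightarrow> 'b::real_normed_vector) \<Rightarrow> 'a \<Rightarrow> 'a \<Rightarrow> 'b" where
  "dir_deriv M f p v = frechet_derivative f (at p within M) v"

definition vector_field :: "'a::euclidean_space set \<Rightarrow> ('a \<Rightarrow> 'a) \<Rightarrow> bool" where
  "vector_field M X \<longleftrightarrow> X differentiable_on M \<and> (\<forall>p\<in>M. X p \<in> tangent_space M p)"

text \<open>The commutator \<open>X(Yf) - Y(Xf)\<close>, evaluated on the ambient coordinate functions.\<close>

definition lie_bracket ::
  "'a::euclidean_space set \<Rightarrow> ('a \<Rightarrow> 'a) \<Rightarrow> ('a \<Rightarrow> 'a) \<Rightarrow> 'a \<Rightarrow> 'a" where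
  "lie_bracket M X Y p = dir_deriv M Y p (X p) - dir_deriv M X p (Y p)"

text \<open>\<open>D p v Y\<close> is the covariant derivative at \<open>p\<close> of the vector field \<open>Y\<close> in the direction \<open>v\<close>. The
  last two clauses say that \<open>D\<close> is torsion-free and compatible with the metric. Vector fields are
  only assumed differentiable; on smooth fields this is the usual Levi-Civita connection.\<close>

definition levi_civita ::
  "'a::euclidean_space set \<Rightarrow> ('a \<Rightarrow> 'a \<Rightarrow> 'a \<Rightarrow> real) \<Rightarrow> ('a \<Rightarrow> 'a \<Rightarrow> ('a \<Rightarrow> 'a) \<Rightarrow> 'a) \<Rightarrow> bool" where
  "levi_civita M g D \<longleftrightarrow>
     (\<forall>p\<in>M. \<forall>v\<in>tangent_space M p. \<forall>Y. vector_field M Y \<longrightarrow> D p v Y \<in> tangent_space M p) \<and>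
     (\<forall>p\<in>M. \<forall>v\<in>tangent_space M p. \<forall>w\<in>tangent_space M p. \<forall>a b::real. \<forall>Y. vector_field M Y \<longrightarrow>
        D p (a *\<^sub>R v + b *\<^sub>R w) Y = a *\<^sub>R D p v Y + b *\<^sub>R D p w Y) \<and>
     (\<forall>p\<in>M. \<forall>v\<in>tangent_space M p. \<forall>Y Z. vector_field M Y \<longrightarrow> vector_field M Z \<longrightarrow>
        D p v (\<lambda>x. Y x + Z x) = D p v Y + D p v Z) \<and>
     (\<forall>p\<in>M. \<forall>v\<in>tangent_space M p. \<forall>f::'a \<Rightarrow> real. \<forall>Y. f differentiable_on M \<longrightarrow> vector_field M Y \<longrightarrow>
        D p v (\<lambda>x. f x *\<^sub>R Y x) = dir_deriv M f p v *\<^sub>R Y p + f p *\<^sub>R D p v Y) \<and>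
     (\<forall>p\<in>M. \<forall>X Y. vector_field M X \<longrightarrow> vector_field M Y \<longrightarrow>
        D p (X p) Y - D p (Y p) X = lie_bracket M X Y p) \<and>
     (\<forall>p\<in>M. \<forall>v\<in>tangent_space M p. \<forall>Y Z. vector_field M Y \<longrightarrow> vector_field M Z \<longrightarrow>
        dir_deriv M (\<lambda>x. g x (Y x) (Z x)) p v = g p (D p v Y) (Z p) + g p (Y p) (D p v Z))"

definition gradient ::
  "'a::euclidean_space set \<Rightarrow> ('a \<Rightarrow> 'a \<Rightarrow> 'a \<Rightarrow> real) \<Rightarrow> ('a \<Rightarrow> real) \<Rightarrow> 'a \<Rightarrow> 'a" where
  "gradient M g f p =
     (THE v. v \<in> tangent_space M p \<and> (\<forall>w\<in>tangent_space M p. g p v w = dir_deriv M f p w))"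

definition orthonormal_tangent_basis ::
  "'a::euclidean_space set \<Rightarrow> ('a \<Rightarrow> 'a \<Rightarrow> 'a \<Rightarrow> real) \<Rightarrow> 'a \<Rightarrow> 'a set \<Rightarrow> bool" where
  "orthonormal_tangent_basis M g p B \<longleftrightarrow>
     finite B \<and> span B = tangent_space M p \<and>
     (\<forall>u\<in>B. \<forall>v\<in>B. g p u v = (if u = v then 1 else 0))"

text \<open>The trace of \<open>v \<mapsto> D p v X\<close> on the tangent space, with \<open>D\<close> the Levi-Civita connection. The
  values picked out by the choice operators do not matter: the trace does not depend on the basis,
  and the Levi-Civita connection of a Riemannian submanifold exists and is unique.\<close>

definition divergence ::
  "'a::euclidean_space set \<Rightarrow> ('a \<Rightarrow> 'a \<Rightarrow> 'a \<Rightarrow> real) \<Rightarrow> ('a \<Rightarrow> 'a) \<Rightarrow> 'a \<Rightarrow> real" where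
  "divergence M g X p =
     (let D = (SOME D. levi_civita M g D);
          B = (SOME B. orthonormal_tangent_basis M g p B)
      in \<Sum>e\<in>B. g p (D p e X) e)"

definition tension_field ::
  "'a::euclidean_space set \<Rightarrow> ('a \<Rightarrow> 'a \<Rightarrow> 'a \<Rightarrow> real) \<Rightarrow> ('a \<Rightarrow> complex) \<Rightarrow> 'a \<Rightarrow> complex" where
  "tension_field M g f p =
     Complex (divergence M g (gradient M g (\<lambda>x. Re (f x))) p)
             (divergence M g (gradient M g (\<lambda>x. Im (f x))) p)"

text \<open>With \<open>f = u + \<i> v\<close> and \<open>h = a + \<i> b\<close>, this is
  \<open>g (\<nabla>u + \<i> \<nabla>v) (\<nabla>a + \<i> \<nabla>b)\<close> for the complex bilinear extension of \<open>g\<close>.\<close>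

definition conformality ::
  "'a::euclidean_space set \<Rightarrow> ('a \<Rightarrow> 'a \<Rightarrow> 'a \<Rightarrow> real) \<Rightarrow> ('a \<Rightarrow> complex) \<Rightarrow> ('a \<Rightarrow> complex)
     \<Rightarrow> 'a \<Rightarrow> complex" where
  "conformality M g f h p =
     (let u = gradient M g (\<lambda>x. Re (f x)) p; v = gradient M g (\<lambda>x. Im (f x)) p;
          a = gradient M g (\<lambda>x. Re (h x)) p; b = gradient M g (\<lambda>x. Im (h x)) p
      in Complex (g p u a - g p v b) (g p u b + g p v a))"

text \<open>The first condition ensures that the two operators are genuinely defined on \<open>f\<close>.\<close>

definition twice_differentiable_on_submanifold ::
  "'a::euclidean_space set \<Rightarrow> ('a \<Rightarrow> 'a \<Rightarrow> 'a \<Rightarrow> real) \<Rightarrow> ('a \<Rightarrow> complex) \<Rightarrow> bool" where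
  "twice_differentiable_on_submanifold M g f \<longleftrightarrow>
     f differentiable_on M \<and>
     vector_field M (gradient M g (\<lambda>x. Re (f x))) \<and>
     vector_field M (gradient M g (\<lambda>x. Im (f x)))"

definition orthogonal_harmonic_family ::
  "'a::euclidean_space set \<Rightarrow> ('a \<Rightarrow> 'a \<Rightarrow> 'a \<Rightarrow> real) \<Rightarrow> ('a \<Rightarrow> complex) set \<Rightarrow> bool" where
  "orthogonal_harmonic_family M g \<Omega> \<longleftrightarrow>
     (\<forall>\<phi>\<in>\<Omega>. twice_differentiable_on_submanifold M g \<phi>) \<and>
     (\<forall>\<phi>\<in>\<Omega>. \<forall>p\<in>M. tension_field M g \<phi> p = 0) \<and>
     (\<forall>\<phi>\<in>\<Omega>. \<forall>\<psi>\<in>\<Omega>. \<forall>p\<in>M. conformality M g \<phi> \<psi> p = 0)"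

section \<open>Unitary groups\<close>

definition conj_transpose :: "complex^'n^'n \<Rightarrow> complex^'n^'n" where
  "conj_transpose A = (\<chi> i j. cnj (A $ j $ i))"

definition unitary_group :: "(complex^'n^'n) set" where
  "unitary_group = {z. z ** conj_transpose z = mat 1}"

definition special_unitary_group :: "(complex^'n^'n) set" where
  "special_unitary_group = {z \<in> unitary_group. det z = 1}"

text \<open>The left-invariant metric on the general linear group which at the identity is
  \<open>(Z, W) \<mapsto> Re (trace (Z W\<^sup>*))\<close>; tangent vectors at \<open>p\<close> are translated back by \<open>p\<inverse>\<close>.\<close>

definition left_invariant_metric ::
  "complex^'n^'n \<Rightarrow> complex^'n^'n \<Rightarrow> complex^'n^'n \<Rightarrow> real" where
  "left_invariant_metric p Z W =
     Re (trace ((matrix_inv p ** Z) ** conj_transpose (matrix_inv p ** W)))"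

definition Q :: "complex^'n \<Rightarrow> 'n \<Rightarrow> complex^'n^'n \<Rightarrow> complex" where
  "Q q \<alpha> z = (\<Sum>j\<in>UNIV. q $ j * z $ j $ \<alpha>)"

definition Q_domain :: "complex^'n \<Rightarrow> (complex^'n^'n) set" where
  "Q_domain q = (\<Inter>\<alpha>. {z \<in> unitary_group. Q q \<alpha> z \<noteq> 0})"

definition Q_family :: "complex^'n \<Rightarrow> (complex^'n^'n \<Rightarrow> complex) set" where
  "Q_family q = {(\<lambda>z. Q q \<alpha> z / Q q \<beta> z) | \<alpha> \<beta>. \<alpha> \<noteq> \<beta>}"

end

theory Submission
  imports Defs
begin

text \<open>
  On the unitary group the metric is the Euclidean inner product, and it is bi-invariant. In the
  left-invariant frame \<open>A \<mapsto> p A\<close> the Levi-Civita connection is therefore the flat one plus half the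
  Lie bracket, and the bracket does not contribute to divergences. If \<open>df (p E) = tr (E N)\<close> on the
  Lie algebra with \<open>tr N = 0\<close>, then the complexified gradient of \<open>f\<close> is \<open>- N\<close>, whence
  \<open>\<kappa> (f, h) = - tr (N\<^sub>f N\<^sub>h)\<close> and \<open>\<tau> f = \<Sum> tr (E dN (p E))\<close>, the sum being over an orthonormal
  basis of the Lie algebra. For \<open>f = Q\<^sub>\<alpha> / Q\<^sub>\<beta>\<close> the matrix \<open>N = c a\<close> has rank one, with \<open>a\<close> the row of
  the \<open>Q\<^sub>k\<close> and \<open>c\<close> a column that satisfies \<open>a c = 0\<close>, for every choice of \<open>\<alpha>\<close> and \<open>\<beta>\<close>. This kills \<open>\<kappa>\<close>
  and, by the Casimir identity, \<open>\<tau>\<close>.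
\<close>

section \<open>Complex matrices\<close>

lemma bounded_bilinear_matrix_mult:
  "bounded_bilinear ((**) :: complex^'m^'l \<Rightarrow> complex^'n^'m \<Rightarrow> complex^'n^'l)"
proof -
  have "bilinear ((**) :: complex^'m^'l \<Rightarrow> complex^'n^'m \<Rightarrow> complex^'n^'l)"
    unfolding bilinear_def
    by (auto intro!: linearI simp: vec_eq_iff matrix_matrix_mult_def algebra_simps sum.distrib
        scaleR_sum_right)
  then show ?thesis
    using bilinear_conv_bounded_bilinear by blast
qed

lemmas matrix_mult_has_derivative [derivative_intros] =
  bounded_bilinear.FDERIV [OF bounded_bilinear_matrix_mult]

lemmas matrix_mult_linear_simps =
  bounded_bilinear.add_left [OF bounded_bilinear_matrix_mult]
  bounded_bilinear.add_right [OF bounded_bilinear_matrix_mult]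
  bounded_bilinear.diff_left [OF bounded_bilinear_matrix_mult]
  bounded_bilinear.diff_right [OF bounded_bilinear_matrix_mult]
  bounded_bilinear.minus_left [OF bounded_bilinear_matrix_mult]
  bounded_bilinear.minus_right [OF bounded_bilinear_matrix_mult]
  bounded_bilinear.scaleR_left [OF bounded_bilinear_matrix_mult]
  bounded_bilinear.scaleR_right [OF bounded_bilinear_matrix_mult]
  bounded_bilinear.zero_left [OF bounded_bilinear_matrix_mult]
  bounded_bilinear.zero_right [OF bounded_bilinear_matrix_mult]

lemma linear_conj_transpose: "linear conj_transpose"
  by (auto intro!: linearI simp: vec_eq_iff conj_transpose_def)

lemmas conj_transpose_linear_simps =
  linear_add [OF linear_conj_transpose] linear_diff [OF linear_conj_transpose]
  linear_scale [OF linear_conj_transpose] linear_0 [OF linear_conj_transpose]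
  linear_neg [OF linear_conj_transpose]

lemma conj_transpose_has_derivative [derivative_intros]:
  assumes "(f has_derivative f') F"
  shows "((\<lambda>x. conj_transpose (f x)) has_derivative (\<lambda>x. conj_transpose (f' x))) F"
  using bounded_linear.has_derivative
    [OF linear_conv_bounded_linear [THEN iffD1, OF linear_conj_transpose] assms] .

lemma conj_transpose_conj_transpose [simp]: "conj_transpose (conj_transpose A) = A"
  by (simp add: conj_transpose_def vec_eq_iff)

lemma conj_transpose_mult: "conj_transpose (A ** B) = conj_transpose B ** conj_transpose A"
  by (simp add: conj_transpose_def vec_eq_iff matrix_matrix_mult_def mult.commute)

lemma conj_transpose_mat: "conj_transpose (mat c) = mat (cnj c)"
  by (auto simp add: conj_transpose_def vec_eq_iff mat_def)

lemma linear_trace: "linear (trace :: complex^'n^'n \<Rightarrow> complex)"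
  by (auto intro!: linearI simp: trace_def sum.distrib scaleR_sum_right)

lemmas trace_linear_simps =
  linear_add [OF linear_trace] linear_diff [OF linear_trace]
  linear_scale [OF linear_trace] linear_0 [OF linear_trace]
  linear_neg [OF linear_trace]

lemma trace_conj_transpose: "trace (conj_transpose A) = cnj (trace A)"
  by (simp add: trace_def conj_transpose_def)

lemma mat_mult_nth: "(mat c ** A) $ i $ j = (c::complex) * A $ i $ j"
  by (simp add: mat_def matrix_matrix_mult_def if_distrib [of "\<lambda>x. x * y" for y] cong: if_cong)

lemma mult_mat_nth: "(A ** mat c) $ i $ j = (c::complex) * A $ i $ j"
  by (simp add: mat_def matrix_matrix_mult_def if_distrib [of "\<lambda>x. y * x" for y] cong: if_cong)

lemma mat_mult_commute: "mat (c::complex) ** A = A ** mat c"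
  by (simp add: vec_eq_iff mat_mult_nth mult_mat_nth)

lemma trace_mat_mult: "trace (mat c ** A) = (c::complex) * trace A"
  by (simp add: trace_def mat_mult_nth sum_distrib_left)

lemma inner_matrix_eq_trace: "A \<bullet> B = Re (trace (A ** conj_transpose B))"
  for A B :: "complex^'n^'n"
  by (simp add: inner_vec_def inner_complex_def trace_def matrix_matrix_mult_def conj_transpose_def)

lemma inner_matrix_mult_left: "(C ** A) \<bullet> B = A \<bullet> (conj_transpose C ** B)"
  for A B C :: "complex^'n^'n"
  by (metis (no_types, lifting) inner_matrix_eq_trace trace_mul_sym matrix_mul_assoc
      conj_transpose_mult conj_transpose_conj_transpose)

lemma inner_matrix_mult_right: "(A ** C) \<bullet> B = A \<bullet> (B ** conj_transpose C)"
  for A B C :: "complex^'n^'n"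
  by (simp add: inner_matrix_eq_trace matrix_mul_assoc [symmetric] conj_transpose_mult)

section \<open>Unitary matrices and the metric along the unitary group\<close>

lemma unitary_groupD:
  assumes "p \<in> unitary_group"
  shows "p ** conj_transpose p = mat 1" "conj_transpose p ** p = mat 1"
  using assms matrix_left_right_inverse unfolding unitary_group_def by auto

lemma unitary_cancel:
  assumes "p \<in> unitary_group"
  shows "p ** (conj_transpose p ** A) = A" "conj_transpose p ** (p ** A) = A"
    "A ** p ** conj_transpose p = A" "A ** conj_transpose p ** p = A"
  using unitary_groupD [OF assms]
  by (metis matrix_mul_assoc matrix_mul_lid matrix_mul_rid)+

lemma inner_unitary_mult:
  fixes A B p :: "complex^'n^'n"
  assumes "p \<in> unitary_group"
  shows "(p ** A) \<bullet> (p ** B) = A \<bullet> B"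
  by (simp add: inner_matrix_mult_left unitary_cancel [OF assms])

lemma inner_conj_transpose_unitary_mult:
  fixes A B p :: "complex^'n^'n"
  assumes "p \<in> unitary_group"
  shows "(conj_transpose p ** A) \<bullet> (conj_transpose p ** B) = A \<bullet> B"
  by (simp add: inner_matrix_mult_left unitary_cancel [OF assms])

lemma matrix_inv_unitary:
  assumes "p \<in> unitary_group"
  shows "matrix_inv p = conj_transpose p"
proof -
  have "invertible p"
    using unitary_groupD [OF assms] unfolding invertible_def by blast
  then have "matrix_inv p ** p = mat 1"
    unfolding invertible_def matrix_inv_def by (metis (mono_tags, lifting) someI_ex)
  then show ?thesis
    by (metis unitary_groupD(1) [OF assms] matrix_mul_assoc matrix_mul_lid matrix_mul_rid)
qed

text \<open>Translating back means multiplying by the unitary matrix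
  \<open>conj_transpose p\<close>, an isometry of the inner product; the metric is therefore
  constant along the group.\<close>

lemma left_invariant_metric_unitary:
  assumes "p \<in> unitary_group"
  shows "left_invariant_metric p A B = A \<bullet> B"
proof -
  have "conj_transpose p \<in> unitary_group"
    using unitary_groupD [OF assms] by (simp add: unitary_group_def)
  then show ?thesis
    by (simp add: left_invariant_metric_def matrix_inv_unitary [OF assms]
        inner_matrix_eq_trace [symmetric] inner_unitary_mult)
qed

lemma unitary_group_mult:
  assumes "p \<in> unitary_group" "r \<in> unitary_group"
  shows "p ** r \<in> unitary_group"
  using assms unitary_cancel [OF assms(2)] unitary_groupD [OF assms(1)]
  by (simp add: unitary_group_def conj_transpose_mult matrix_mul_assoc)

section \<open>Skew-Hermitian matrices\<close>

definition skew_hermitian :: "(complex^'n^'n) set" where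
  "skew_hermitian = {A. conj_transpose A = - A}"

definition traceless_skew_hermitian :: "(complex^'n^'n) set" where
  "traceless_skew_hermitian = {A \<in> skew_hermitian. trace A = 0}"

text \<open>The orthogonal projection onto the real subspace of skew-Hermitian matrices.\<close>

definition skew_part :: "complex^'n^'n \<Rightarrow> complex^'n^'n" where
  "skew_part A = (1/2) *\<^sub>R (A - conj_transpose A)"

definition bracket :: "complex^'n^'n \<Rightarrow> complex^'n^'n \<Rightarrow> complex^'n^'n" where
  "bracket A B = A ** B - B ** A"

lemma subspace_skew_hermitian: "subspace skew_hermitian"
  by (simp add: subspace_def skew_hermitian_def conj_transpose_linear_simps)

lemma subspace_traceless_skew_hermitian: "subspace traceless_skew_hermitian"
  by (simp add: subspace_def traceless_skew_hermitian_def skew_hermitian_def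
      conj_transpose_linear_simps trace_linear_simps)

lemma bracket_skew_hermitian:
  assumes "A \<in> skew_hermitian" "B \<in> skew_hermitian"
  shows "bracket A B \<in> skew_hermitian"
  using assms
  by (simp add: bracket_def skew_hermitian_def conj_transpose_linear_simps conj_transpose_mult
      matrix_mult_linear_simps)

lemma trace_bracket: "trace (bracket A B) = 0"
  by (simp add: bracket_def trace_linear_simps trace_mul_sym [of A B])

text \<open>Left and right multiplication by a skew-Hermitian matrix are both skew-adjoint. This is
  the infinitesimal form of bi-invariance; metricity of the connection and the divergence formula
  rest on it.\<close>

lemma inner_bracket_skew_hermitian:
  assumes "A \<in> skew_hermitian" "C \<in> skew_hermitian"
  shows "bracket A B \<bullet> C = - (B \<bullet> bracket A C)"
proof -
  have "(A ** B) \<bullet> C = - (B \<bullet> (A ** C))" "(B ** A) \<bullet> C = - (B \<bullet> (C ** A))"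
    using assms
    by (simp add: inner_matrix_mult_left skew_hermitian_def matrix_mult_linear_simps,
        simp add: inner_matrix_mult_right skew_hermitian_def matrix_mult_linear_simps)
  then show ?thesis
    by (simp add: bracket_def inner_diff_left inner_diff_right)
qed

lemma skew_part_mem: "skew_part A \<in> skew_hermitian"
  by (simp add: skew_part_def skew_hermitian_def conj_transpose_linear_simps algebra_simps
      flip: scaleR_minus_right)

lemma trace_skew_part: "trace A = 0 \<Longrightarrow> trace (skew_part A) = 0"
  by (simp add: skew_part_def trace_linear_simps trace_conj_transpose)

lemma linear_skew_part: "linear skew_part"
  by (auto intro!: linearI simp: skew_part_def conj_transpose_linear_simps algebra_simps)

text \<open>Moving the transposition across the inner product gives
  \<open>conj_transpose A \<bullet> E = - (A \<bullet> E)\<close>, so the Hermitian part of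
  \<open>A\<close> is orthogonal to \<open>E\<close>.\<close>

lemma inner_skew_part:
  assumes "E \<in> skew_hermitian"
  shows "skew_part A \<bullet> E = A \<bullet> E"
proof -
  have "conj_transpose A \<bullet> E = conj_transpose E \<bullet> A"
    by (metis inner_commute inner_matrix_mult_left matrix_mul_rid inner_matrix_mult_right matrix_mul_lid)
  then show ?thesis
    using assms
    by (simp add: skew_part_def skew_hermitian_def inner_diff_left inner_commute [of A])
qed

text \<open>A dictionary between complex traces and real inner products, from which gradients of
  real and imaginary parts are read off. The imaginary part reduces to the real one because
  \<open>Re (\<i> * w) = - Im w\<close>.\<close>

lemma trace_mult_skew_hermitian:
  assumes "E \<in> skew_hermitian"
  shows "trace (E ** Z) = Complex (- (skew_part Z \<bullet> E)) (skew_part (mat \<i> ** Z) \<bullet> E)"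
proof -
  have *: "skew_part Z \<bullet> E = - Re (trace (E ** Z))" for Z
    using assms unfolding inner_skew_part [OF assms]
    by (simp add: skew_hermitian_def inner_matrix_eq_trace matrix_mult_linear_simps
        trace_linear_simps trace_mul_sym [of Z])
  have "trace (E ** (mat \<i> ** Z)) = \<i> * trace (E ** Z)"
    by (metis mat_mult_commute matrix_mul_assoc trace_mat_mult)
  then show ?thesis
    by (simp add: * complex_eq_iff)
qed

section \<open>Derivatives along a submanifold\<close>

lemma has_vector_derivative_at_0_iff:
  "(f has_vector_derivative D) (at 0) \<longleftrightarrow> ((\<lambda>t. (1 / t) *\<^sub>R (f t - f 0)) \<longlongrightarrow> D) (at 0)"
proof -
  have "norm ((f y - f 0) - y *\<^sub>R D) / norm y = norm ((1 / y) *\<^sub>R (f y - f 0) - D)"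
    if "y \<noteq> 0" for y :: real
  proof -
    have "(1 / y) *\<^sub>R (f y - f 0) - D = (1 / y) *\<^sub>R ((f y - f 0) - y *\<^sub>R D)"
      using that by (simp add: scaleR_diff_right)
    then show ?thesis
      by simp
  qed
  then have "((\<lambda>y. norm ((f y - f 0) - y *\<^sub>R D) / norm y) \<longlongrightarrow> 0) (at 0) \<longleftrightarrow>
      ((\<lambda>y. norm ((1 / y) *\<^sub>R (f y - f 0) - D)) \<longlongrightarrow> 0) (at 0)"
    by (intro filterlim_cong) (auto simp: eventually_at_filter)
  also have "\<dots> \<longleftrightarrow> ((\<lambda>t. (1 / t) *\<^sub>R (f t - f 0)) \<longlongrightarrow> D) (at 0)"
    by (simp add: tendsto_norm_zero_iff LIM_zero_iff)
  finally show ?thesis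
    by (simp add: has_vector_derivative_def has_derivative_iff_norm bounded_linear_scaleR_left)
qed

lemma tangent_spaceE:
  assumes "v \<in> tangent_space M p"
  obtains \<gamma> where "\<gamma> 0 = p" "\<forall>\<^sub>F t in at 0. \<gamma> t \<in> M" "(\<gamma> has_vector_derivative v) (at 0)"
  using assms unfolding tangent_space_def by auto

lemma has_vector_derivative_along_curve:
  assumes "p \<in> M" and \<gamma>: "\<gamma> 0 = p" "\<forall>\<^sub>F t in at (0::real). \<gamma> t \<in> M" "(\<gamma> has_vector_derivative v) (at 0)"
    and f: "(f has_derivative f') (at p within M)"
  shows "((\<lambda>t. f (\<gamma> t)) has_vector_derivative f' v) (at 0)"
proof -
  let ?S = "{t. \<gamma> t \<in> M}"
  have "(\<gamma> has_derivative (\<lambda>t. t *\<^sub>R v)) (at 0 within ?S)"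
    using \<gamma>(3) has_derivative_at_withinI unfolding has_vector_derivative_def by blast
  moreover have "(f has_derivative f') (at (\<gamma> 0) within \<gamma> ` ?S)"
    using f \<gamma>(1) by (auto intro: has_derivative_subset)
  ultimately have "((f \<circ> \<gamma>) has_derivative (f' \<circ> (\<lambda>t. t *\<^sub>R v))) (at 0 within ?S)"
    by (rule diff_chain_within)
  \<comment> \<open>The curve lies in \<open>M\<close> at all small nonzero times, so the
    restriction to such times leaves the filter unchanged.\<close>
  moreover have "at 0 within ?S = at 0"
    using \<gamma>(2) unfolding filter_eq_iff eventually_at_filter
    by (auto elim: eventually_elim2)
  moreover have "f' (t *\<^sub>R v) = t *\<^sub>R f' v" for t
    using has_derivative_bounded_linear [OF f] by (simp add: linear_scale bounded_linear.linear)
  ultimately show ?thesis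
    by (simp add: has_vector_derivative_def o_def)
qed

text \<open>Derivatives within \<open>M\<close> are determined on tangent vectors even where \<open>at p within M\<close> fails to
  determine the linear map.\<close>

lemma dir_deriv_eq:
  assumes "p \<in> M" "v \<in> tangent_space M p" and f: "(f has_derivative f') (at p within M)"
    and h: "\<And>x. x \<in> M \<Longrightarrow> h x = f x"
  shows "dir_deriv M h p v = f' v"
proof -
  obtain \<gamma> where \<gamma>: "\<gamma> 0 = p" "\<forall>\<^sub>F t in at 0. \<gamma> t \<in> M" "(\<gamma> has_vector_derivative v) (at 0)"
    using assms(2) by (rule tangent_spaceE)
  have h': "(h has_derivative f') (at p within M)"
    using has_derivative_transform [OF \<open>p \<in> M\<close> h f] .
  then have "(h has_derivative frechet_derivative h (at p within M)) (at p within M)"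
    using differentiableI frechet_derivative_works by blast
  then have "((\<lambda>t. h (\<gamma> t)) has_vector_derivative dir_deriv M h p v) (at 0)"
    unfolding dir_deriv_def by (rule has_vector_derivative_along_curve [OF \<open>p \<in> M\<close> \<gamma>])
  moreover have "((\<lambda>t. h (\<gamma> t)) has_vector_derivative f' v) (at 0)"
    using h' by (rule has_vector_derivative_along_curve [OF \<open>p \<in> M\<close> \<gamma>])
  ultimately show ?thesis
    by (rule vector_derivative_unique_at)
qed

lemma has_derivative_dir_deriv:
  assumes "f differentiable_on M" "p \<in> M"
  shows "(f has_derivative dir_deriv M f p) (at p within M)"
  using assms frechet_derivative_works unfolding differentiable_on_def dir_deriv_def by auto

text \<open>Difference quotients along a curve in \<open>M\<close> stay in \<open>V\<close>, and a
  subspace of a Euclidean space is closed.\<close>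

lemma dir_deriv_mem_subspace:
  fixes f :: "'a::euclidean_space \<Rightarrow> 'b::euclidean_space"
  assumes "subspace V" and V: "\<And>x. x \<in> M \<Longrightarrow> f x \<in> V"
    and "f differentiable_on M" "p \<in> M" "v \<in> tangent_space M p"
  shows "dir_deriv M f p v \<in> V"
proof -
  obtain \<gamma> where \<gamma>: "\<gamma> 0 = p" "\<forall>\<^sub>F t in at 0. \<gamma> t \<in> M" "(\<gamma> has_vector_derivative v) (at 0)"
    using assms(5) by (rule tangent_spaceE)
  have "((\<lambda>t. f (\<gamma> t)) has_vector_derivative dir_deriv M f p v) (at 0)"
    using has_derivative_dir_deriv [OF assms(3,4)]
    by (rule has_vector_derivative_along_curve [OF \<open>p \<in> M\<close> \<gamma>])
  then have lim: "((\<lambda>t. (1 / t) *\<^sub>R (f (\<gamma> t) - f (\<gamma> 0))) \<longlongrightarrow> dir_deriv M f p v) (at 0)"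
    by (simp add: has_vector_derivative_at_0_iff)
  have "\<forall>\<^sub>F t in at 0. (1 / t) *\<^sub>R (f (\<gamma> t) - f (\<gamma> 0)) \<in> V"
    using \<gamma>(2) by eventually_elim (use V \<open>p \<in> M\<close> \<gamma>(1) \<open>subspace V\<close> in \<open>simp add: subspace_scale subspace_diff\<close>)
  then show ?thesis
    using Lim_in_closed_set [OF closed_subspace [OF \<open>subspace V\<close>] _ _ lim] by simp
qed

text \<open>A curve differentiable at 0 is continuous there, so near time 0 it cannot leave
  \<open>T\<close>. This carries tangent spaces of the whole groups over to the domains of the
  quotients.\<close>

lemma tangent_space_Int_open:
  assumes "open T" "p \<in> T"
  shows "tangent_space (S \<inter> T) p = tangent_space S p"
proof -
  have "\<forall>\<^sub>F t in at 0. \<gamma> t \<in> T"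
    if "\<gamma> 0 = p" "(\<gamma> has_vector_derivative v) (at 0)" for \<gamma> v
  proof -
    have "isCont \<gamma> 0"
      using that(2) has_vector_derivative_continuous by blast
    then have "(\<gamma> \<longlongrightarrow> p) (at 0)"
      using that(1) by (simp add: isCont_def)
    then show ?thesis
      using assms by (simp add: topological_tendstoD)
  qed
  then show ?thesis
    unfolding tangent_space_def by (fastforce simp: eventually_conj_iff)
qed

section \<open>Tangent spaces of the unitary groups\<close>

lemma bounded_linear_matrix_mult_left: "bounded_linear (\<lambda>A :: complex^'n^'m. p ** A)"
  by (rule bounded_bilinear.bounded_linear_right [OF bounded_bilinear_matrix_mult])

text \<open>Differentiate \<open>conj_transpose x ** x\<close>, which is constant on the unitary
  group.\<close>

lemma skew_hermitian_if_tangent: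
  fixes p v :: "complex^'n^'n"
  assumes "p \<in> unitary_group" "v \<in> tangent_space unitary_group p"
  shows "conj_transpose p ** v \<in> skew_hermitian"
proof -
  have "((\<lambda>x. conj_transpose x ** x) has_derivative
      (\<lambda>h. conj_transpose p ** h + conj_transpose h ** p)) (at p within unitary_group)"
    by (auto intro!: derivative_eq_intros)
  then have "dir_deriv unitary_group (\<lambda>x. mat 1) p v = conj_transpose p ** v + conj_transpose v ** p"
    by (rule dir_deriv_eq [OF assms]) (simp add: unitary_groupD)
  moreover have "dir_deriv unitary_group (\<lambda>x. mat 1) p v = (0 :: complex^'n^'n)"
    by (rule dir_deriv_eq [OF assms, where f = "\<lambda>x. mat 1" and f' = "\<lambda>x. 0"]) auto
  ultimately show ?thesis
    by (simp add: skew_hermitian_def conj_transpose_mult eq_neg_iff_add_eq_0 add.commute)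
qed

text \<open>\<open>g\<close> is the Cayley transform \<open>(I + A) (I - A)\<^sup>-\<^sup>1\<close>. The equation gives the velocity of \<open>g\<close> along
  \<open>t A\<close> from the boundedness of the unitary group, without differentiating a matrix inverse.\<close>

lemma cayley_transform:
  fixes A :: "complex^'n^'n"
  assumes "A \<in> skew_hermitian"
  obtains g where "g \<in> unitary_group" "g - mat 1 = A ** (g + mat 1)"
proof -
  have skew: "conj_transpose A = - A"
    using assms by (simp add: skew_hermitian_def)
  define K where "K = mat 1 - A"
  have K': "conj_transpose K = mat 1 + A"
    by (simp add: K_def conj_transpose_linear_simps conj_transpose_mat skew)
  \<comment> \<open>Both factors are polynomials in \<open>A\<close>. Commutation is what makes
    \<open>conj_transpose K ** R\<close>, with \<open>R\<close> the inverse of \<open>K\<close>,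
    unitary.\<close>
  have comm: "conj_transpose K ** K = K ** conj_transpose K"
    unfolding K' by (simp add: K_def matrix_mult_linear_simps)
  have "x = 0" if "K *v x = 0" for x
  proof -
    \<comment> \<open>A square matrix with every column equal to \<open>x\<close>, so that the inner
      product of matrices can be used: skewness of \<open>A\<close> makes \<open>A ** X\<close>
      orthogonal to \<open>X\<close>, while \<open>A ** X = X\<close>.\<close>
    define X :: "complex^'n^'n" where "X = (\<chi> i j. x $ i)"
    have "K ** X = 0"
      using that by (simp add: X_def vec_eq_iff matrix_matrix_mult_def matrix_vector_mult_def)
    then have AX: "A ** X = X"
      by (simp add: K_def matrix_mult_linear_simps)
    have "(A ** X) \<bullet> X = - (X \<bullet> (A ** X))"
      by (simp add: inner_matrix_mult_left [of A] skew matrix_mult_linear_simps)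
    then have "X = 0"
      by (simp add: AX)
    then show "x = 0"
      by (simp add: X_def vec_eq_iff)
  qed
  then obtain R where RK: "R ** K = mat 1"
    using matrix_left_invertible_ker [of K] by blast
  then have KR: "K ** R = mat 1"
    using matrix_left_right_inverse by blast
  define g where "g = conj_transpose K ** R"
  have RK': "conj_transpose R ** conj_transpose K = mat 1"
    by (metis KR conj_transpose_mult conj_transpose_mat complex_cnj_one)
  have Kg: "K ** g = conj_transpose K"
    by (metis KR comm g_def matrix_mul_assoc matrix_mul_rid)
  have "conj_transpose g ** g = conj_transpose R ** (K ** conj_transpose K) ** R"
    by (simp add: g_def conj_transpose_mult matrix_mul_assoc)
  also have "\<dots> = mat 1"
    by (metis KR RK' comm matrix_mul_assoc matrix_mul_lid)
  finally have "g \<in> unitary_group"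
    unfolding unitary_group_def using matrix_left_right_inverse by blast
  moreover have "g - mat 1 = A ** (g + mat 1)"
    using Kg unfolding K' by (simp add: K_def matrix_mult_linear_simps algebra_simps)
  ultimately show thesis
    by (rule that)
qed

lemma norm_unitary:
  assumes "g \<in> unitary_group"
  shows "norm (g :: complex^'n^'n) = sqrt CARD('n)"
  using unitary_groupD [OF assms] by (simp add: norm_eq_sqrt_inner inner_matrix_eq_trace trace_I)

lemma skew_hermitian_tangent_at_mat_1:
  fixes A :: "complex^'n^'n"
  assumes "A \<in> skew_hermitian"
  shows "A \<in> tangent_space unitary_group (mat 1)"
proof -
  \<comment> \<open>The Cayley transform doubles velocities at the origin, hence the factor
    \<open>t / 2\<close>.\<close>
  have "\<exists>g. g \<in> unitary_group \<and> g - mat 1 = ((t / 2) *\<^sub>R A) ** (g + mat 1)" for t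
    using cayley_transform [of "(t / 2) *\<^sub>R A"] assms subspace_scale [OF subspace_skew_hermitian]
    by metis
  then obtain g where g: "\<And>t. g t \<in> unitary_group"
      "\<And>t. g t - mat 1 = ((t / 2) *\<^sub>R A) ** (g t + mat 1)"
    by metis
  have g0: "g 0 = mat 1"
    using g(2) [of 0] by (simp add: matrix_mult_linear_simps)
  have lin: "bounded_linear (\<lambda>B :: complex^'n^'n. (1 / 2) *\<^sub>R (A ** B))"
    using bounded_linear_scaleR_right bounded_linear_matrix_mult_left bounded_linear_compose by blast
  then obtain K where K: "\<And>B :: complex^'n^'n. norm ((1 / 2) *\<^sub>R (A ** B)) \<le> norm B * K"
    using bounded_linear.bounded [OF lin] by blast
  have g': "g t - mat 1 = t *\<^sub>R ((1 / 2) *\<^sub>R (A ** (g t + mat 1)))" for t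
    using g(2) [of t] by (simp add: matrix_mult_linear_simps scaleR_add_right)
  \<comment> \<open>The \<open>g t\<close> are chosen separately for each \<open>t\<close>.
    Continuity at 0 comes from the equation itself: unitary matrices have constant norm, so
    \<open>g t - mat 1\<close> is of order \<open>t\<close>.\<close>
  have "norm (g t - mat 1) \<le> norm t * ((sqrt CARD('n) + norm (mat 1 :: complex^'n^'n)) * \<bar>K\<bar>)" for t
  proof -
    have "norm ((1 / 2) *\<^sub>R (A ** (g t + mat 1))) \<le> norm (g t + mat 1) * \<bar>K\<bar>"
      using K [of "g t + mat 1"] by (meson abs_ge_self mult_left_mono norm_ge_zero order_trans)
    also have "\<dots> \<le> (sqrt CARD('n) + norm (mat 1 :: complex^'n^'n)) * \<bar>K\<bar>"
      using norm_triangle_ineq [of "g t" "mat 1"] norm_unitary [OF g(1) [of t]]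
      by (intro mult_right_mono) auto
    finally show ?thesis
      unfolding g' norm_scaleR [of t] real_norm_def by (rule mult_left_mono) simp
  qed
  moreover have "((\<lambda>t::real. norm t * ((sqrt CARD('n) + norm (mat 1 :: complex^'n^'n)) * \<bar>K\<bar>)) \<longlongrightarrow> 0) (at 0)"
    by (intro tendsto_mult_left_zero tendsto_norm_zero tendsto_ident_at)
  ultimately have "((\<lambda>t. g t - mat 1) \<longlongrightarrow> 0) (at 0)"
    by (rule Lim_null_comparison [OF always_eventually [OF allI]])
  then have lim: "(g \<longlongrightarrow> mat 1) (at 0)"
    by (simp add: LIM_zero_iff)
  \<comment> \<open>By the same equation the difference quotient is a bounded linear function of
    \<open>g t + mat 1\<close>, so its limit follows from that of \<open>g\<close>.\<close>
  have "((\<lambda>t. (1 / 2) *\<^sub>R (A ** (g t + mat 1))) \<longlongrightarrow> (1 / 2) *\<^sub>R (A ** (mat 1 + mat 1))) (at 0)"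
    by (intro bounded_linear.tendsto [OF lin] tendsto_intros lim)
  moreover have "\<forall>\<^sub>F t in at 0. (1 / 2) *\<^sub>R (A ** (g t + mat 1)) = (1 / t) *\<^sub>R (g t - g 0)"
    unfolding g0 g' by (auto simp: eventually_at_filter)
  ultimately have "((\<lambda>t. (1 / t) *\<^sub>R (g t - g 0)) \<longlongrightarrow> (1 / 2) *\<^sub>R (A ** (mat 1 + mat 1))) (at 0)"
    by (rule Lim_transform_eventually)
  moreover have "(1 / 2) *\<^sub>R (A ** (mat 1 + mat 1)) = A"
    by (simp add: scaleR_2 [symmetric] matrix_mult_linear_simps)
  ultimately have "((\<lambda>t. (1 / t) *\<^sub>R (g t - g 0)) \<longlongrightarrow> A) (at 0)"
    by simp
  then have "(g has_vector_derivative A) (at 0)"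
    by (simp add: has_vector_derivative_at_0_iff)
  then show ?thesis
    unfolding tangent_space_def using g0 g(1) by auto
qed

lemma tangent_space_translate:
  fixes p A :: "complex^'n^'n"
  assumes "A \<in> tangent_space M (mat 1)" "\<And>x. x \<in> M \<Longrightarrow> p ** x \<in> N"
  shows "p ** A \<in> tangent_space N p"
proof -
  obtain \<gamma> where \<gamma>: "\<gamma> 0 = mat 1" "\<forall>\<^sub>F t in at 0. \<gamma> t \<in> M" "(\<gamma> has_vector_derivative A) (at 0)"
    using assms(1) by (rule tangent_spaceE)
  have "((\<lambda>t. p ** \<gamma> t) has_vector_derivative p ** A) (at 0)"
    using bounded_linear.has_vector_derivative [OF bounded_linear_matrix_mult_left \<gamma>(3)] .
  moreover have "\<forall>\<^sub>F t in at 0. p ** \<gamma> t \<in> N"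
    using \<gamma>(2) by eventually_elim (rule assms(2))
  ultimately show ?thesis
    unfolding tangent_space_def using \<gamma>(1) by (auto intro!: exI [of _ "\<lambda>t. p ** \<gamma> t"])
qed

lemma tangent_space_unitary_group:
  assumes "p \<in> unitary_group"
  shows "tangent_space unitary_group p = (**) p ` skew_hermitian"
proof (intro equalityI subsetI)
  fix v assume "v \<in> tangent_space unitary_group p"
  then show "v \<in> (**) p ` skew_hermitian"
    using skew_hermitian_if_tangent [OF assms] unitary_cancel [OF assms] by (metis imageI)
next
  fix v assume "v \<in> (**) p ` skew_hermitian"
  then show "v \<in> tangent_space unitary_group p"
    using tangent_space_translate [OF skew_hermitian_tangent_at_mat_1] unitary_group_mult [OF assms]
    by blast
qed

section \<open>The determinant and the tangent spaces of the special unitary group\<close>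

lemma det_has_derivative_at_mat_1:
  fixes f :: "'a::real_normed_vector \<Rightarrow> complex^'n^'n"
  assumes f: "(f has_derivative f') (at x within S)" and 1: "f x = mat 1"
  shows "((\<lambda>y. det (f y)) has_derivative (\<lambda>h. trace (f' h))) (at x within S)"
proof -
  let ?P = "{s. s permutes (UNIV :: 'n set)}"
  have nth: "((\<lambda>y. f y $ i $ j) has_derivative (\<lambda>h. f' h $ i $ j)) (at x within S)" for i j
    by (intro bounded_linear.has_derivative [OF bounded_linear_vec_nth] f)
  have "((\<lambda>y. det (f y)) has_derivative (\<lambda>h. \<Sum>s\<in>?P. of_int (sign s) *
      (\<Sum>i\<in>UNIV. f' h $ i $ s i * (\<Prod>j\<in>UNIV - {i}. f x $ j $ s j)))) (at x within S)"
    unfolding det_def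
    by (intro has_derivative_sum has_derivative_mult_right has_derivative_prod nth)
  also have "(\<lambda>h. \<Sum>s\<in>?P. of_int (sign s) *
      (\<Sum>i\<in>UNIV. f' h $ i $ s i * (\<Prod>j\<in>UNIV - {i}. f x $ j $ s j))) = (\<lambda>h. trace (f' h))"
  proof
    fix h
    \<comment> \<open>Each term of the differentiated Leibniz formula keeps all factors but one. A
      permutation other than the identity moves at least two indices, so a vanishing off-diagonal
      entry remains.\<close>
    have zero: "(\<Prod>j\<in>UNIV - {i}. f x $ j $ s j) = 0" if "s \<in> ?P" "s \<noteq> id" for s i
    proof -
      have "\<exists>j. j \<noteq> i \<and> s j \<noteq> j"
      proof (rule ccontr)
        assume "\<not> ?thesis"
        then have fixed: "\<And>j. j \<noteq> i \<Longrightarrow> s j = j"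
          by auto
        \<comment> \<open>If \<open>s i\<close> differed from \<open>i\<close>, it would be fixed by
          \<open>s\<close>, and injectivity would give \<open>s i = i\<close>.\<close>
        moreover have "s i = i"
          using fixed [of "s i"] permutes_inj [of s UNIV] that(1) by (auto dest: injD)
        ultimately show False
          using that(2) by (metis eq_id_iff)
      qed
      then obtain j where "j \<noteq> i" "s j \<noteq> j"
        by blast
      then show ?thesis
        by (intro prod_zero bexI [of _ j]) (auto simp: 1 mat_def)
    qed
    have "(\<Sum>s\<in>?P. of_int (sign s) *
        (\<Sum>i\<in>UNIV. f' h $ i $ s i * (\<Prod>j\<in>UNIV - {i}. f x $ j $ s j)))
      = (\<Sum>s\<in>{id}. of_int (sign s) *
        (\<Sum>i\<in>UNIV. f' h $ i $ s i * (\<Prod>j\<in>UNIV - {i}. f x $ j $ s j)))"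
      by (rule sum.mono_neutral_right) (auto simp: permutes_id zero finite_permutations)
    also have "\<dots> = trace (f' h)"
      by (simp add: 1 mat_def trace_def)
    finally show "(\<Sum>s\<in>?P. of_int (sign s) *
        (\<Sum>i\<in>UNIV. f' h $ i $ s i * (\<Prod>j\<in>UNIV - {i}. f x $ j $ s j))) = trace (f' h)" .
  qed
  finally show ?thesis .
qed

lemma det_conj_transpose: "det (conj_transpose A) = cnj (det A)"
proof -
  have "det (conj_transpose A) = det (\<chi> i j. cnj (A $ i $ j))"
    using det_transpose [of "\<chi> i j. cnj (A $ i $ j)"]
    by (simp add: conj_transpose_def transpose_def)
  also have "\<dots> = cnj (det A)"
    by (simp add: det_def)
  finally show ?thesis .
qed

lemma special_unitary_group_mult:
  assumes "p \<in> special_unitary_group" "r \<in> special_unitary_group"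
  shows "p ** r \<in> special_unitary_group"
  using assms by (simp add: special_unitary_group_def unitary_group_mult det_mul)

text \<open>The function \<open>det (conj_transpose p ** x)\<close> is constantly 1 on the group.
  The translation moves the base point to the identity, where the differential of the determinant is
  the trace.\<close>

lemma traceless_if_tangent:
  assumes p: "p \<in> special_unitary_group" and v: "v \<in> tangent_space special_unitary_group p"
  shows "trace (conj_transpose p ** v) = 0"
proof -
  have "((\<lambda>x. det (conj_transpose p ** x)) has_derivative (\<lambda>h. trace (conj_transpose p ** h)))
      (at p within special_unitary_group)"
    using p
    by (intro det_has_derivative_at_mat_1 bounded_linear.has_derivative
        [OF bounded_linear_matrix_mult_left] has_derivative_ident)
      (simp add: unitary_groupD special_unitary_group_def)
  then have "dir_deriv special_unitary_group (\<lambda>x. 1) p v = trace (conj_transpose p ** v)"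
    by (rule dir_deriv_eq [OF p v])
      (use p in \<open>simp add: special_unitary_group_def det_mul det_conj_transpose\<close>)
  moreover have "dir_deriv special_unitary_group (\<lambda>x. 1) p v = (0 :: complex)"
    by (rule dir_deriv_eq [OF p v, where f = "\<lambda>x. 1" and f' = "\<lambda>x. 0"]) auto
  ultimately show ?thesis
    by simp
qed

text \<open>The determinant of a curve in the unitary group is corrected by rescaling one column; this
  does not change the initial velocity when that velocity has trace zero.\<close>

lemma traceless_tangent_at_mat_1:
  fixes A :: "complex^'n^'n"
  assumes "A \<in> traceless_skew_hermitian"
  shows "A \<in> tangent_space special_unitary_group (mat 1)"
proof -
  have A: "A \<in> skew_hermitian" "trace A = 0"
    using assms by (auto simp: traceless_skew_hermitian_def)
  obtain \<gamma> where \<gamma>: "\<gamma> 0 = mat 1" "\<forall>\<^sub>F t in at 0. \<gamma> t \<in> unitary_group"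
      "(\<gamma> has_vector_derivative A) (at 0)"
    using skew_hermitian_tangent_at_mat_1 [OF A(1)] by (rule tangent_spaceE)
  obtain k :: 'n where True
    by blast
  define P :: "complex \<Rightarrow> complex^'n^'n" where "P c = (\<chi> i j. if i = k \<and> j = k then c else 0)" for c
  \<comment> \<open>Column \<open>k\<close> is multiplied by the conjugate of the determinant. On
    the unitary group this is the inverse of the determinant, and conjugation is real-linear, hence
    easy to differentiate.\<close>
  define \<delta> where "\<delta> t = \<gamma> t ** (mat 1 + P (cnj (det (\<gamma> t)) - 1))" for t
  have "linear P"
    by (auto intro!: linearI simp: P_def vec_eq_iff)
  then have P: "bounded_linear P"
    by (simp add: linear_conv_bounded_linear)
  have "((\<lambda>t. det (\<gamma> t)) has_derivative (\<lambda>t. trace (t *\<^sub>R A))) (at 0)"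
    using det_has_derivative_at_mat_1 \<gamma>(1,3) unfolding has_vector_derivative_def by blast
  then have "((\<lambda>t. det (\<gamma> t)) has_derivative (\<lambda>t. 0)) (at 0)"
    by (simp add: trace_linear_simps A(2))
  then have "(\<delta> has_derivative (\<lambda>t. \<gamma> 0 ** (0 + P (cnj 0 - 0))
      + (t *\<^sub>R A) ** (mat 1 + P (cnj (det (\<gamma> 0)) - 1)))) (at 0)"
    using \<gamma>(3) unfolding \<delta>_def has_vector_derivative_def
    by (intro matrix_mult_has_derivative has_derivative_add has_derivative_const has_derivative_diff
        bounded_linear.has_derivative [OF P] bounded_linear.has_derivative [OF bounded_linear_cnj])
  then have "(\<delta> has_vector_derivative A) (at 0)"
    by (simp add: \<gamma>(1) linear_0 [OF \<open>linear P\<close>] has_vector_derivative_def matrix_mult_linear_simps)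
  moreover have "\<delta> 0 = mat 1"
    by (simp add: \<delta>_def \<gamma>(1) linear_0 [OF \<open>linear P\<close>])
  moreover have "\<delta> t \<in> special_unitary_group" if "\<gamma> t \<in> unitary_group" for t
  proof -
    define d where "d = cnj (det (\<gamma> t))"
    define D where "D = mat 1 + P (d - 1)"
    have "det (\<gamma> t ** conj_transpose (\<gamma> t)) = 1"
      using that by (simp add: unitary_groupD)
    then have d: "d * cnj d = 1"
      by (simp add: d_def det_mul det_conj_transpose mult.commute)
    have D: "D $ i $ j = (if i = j then if i = k then d else 1 else 0)" for i j
      by (auto simp: D_def P_def mat_def)
    have "D ** conj_transpose D = mat 1"
      using d by (simp add: vec_eq_iff matrix_matrix_mult_def conj_transpose_def D mat_def
          if_distrib [of "\<lambda>x. x * y" for y] cong: if_cong)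
    then have "D \<in> unitary_group"
      by (simp add: unitary_group_def)
    moreover have "det D = d"
      by (simp add: det_diagonal D prod.delta)
    ultimately show ?thesis
      using that d unfolding \<delta>_def D_def [symmetric] d_def [symmetric]
      by (simp add: special_unitary_group_def unitary_group_mult det_mul)
        (simp add: d_def mult.commute)
  qed
  ultimately show ?thesis
    unfolding tangent_space_def using \<gamma>(2) by (auto intro!: exI [of _ \<delta>] elim: eventually_mono)
qed

lemma tangent_space_special_unitary_group:
  assumes "p \<in> special_unitary_group"
  shows "tangent_space special_unitary_group p = (**) p ` traceless_skew_hermitian"
proof (intro equalityI subsetI)
  fix v assume v: "v \<in> tangent_space special_unitary_group p"
  have p: "p \<in> unitary_group"
    using assms by (simp add: special_unitary_group_def)
  have "v \<in> tangent_space unitary_group p"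
    using v unfolding tangent_space_def special_unitary_group_def
    by (auto elim!: eventually_mono)
  then have "conj_transpose p ** v \<in> traceless_skew_hermitian"
    using skew_hermitian_if_tangent [OF p] traceless_if_tangent [OF assms v]
    by (simp add: traceless_skew_hermitian_def)
  then show "v \<in> (**) p ` traceless_skew_hermitian"
    using unitary_cancel(1) [OF p] by (metis imageI)
next
  fix v assume "v \<in> (**) p ` traceless_skew_hermitian"
  then show "v \<in> tangent_space special_unitary_group p"
    using tangent_space_translate [OF traceless_tangent_at_mat_1]
      special_unitary_group_mult [OF assms] by blast
qed

section \<open>Riemannian geometry of the unitary groups in a left-invariant frame\<close>

lemma orthonormal_tangent_basisD:
  assumes "orthonormal_tangent_basis M g p B"
  shows "finite B" "span B = tangent_space M p"
    "u \<in> B \<Longrightarrow> v \<in> B \<Longrightarrow> g p u v = (if u = v then 1 else 0)"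
  using assms unfolding orthonormal_tangent_basis_def by auto

text \<open>\<open>L\<close> is the Lie algebra of the unitary or of the special unitary group, of which \<open>M\<close> is an open
  subset. Closedness of \<open>L\<close> under brackets is automatic, because brackets are traceless.\<close>

locale unitary_submanifold =
  fixes M L :: "(complex^'n^'n) set"
  assumes unitary: "M \<subseteq> unitary_group"
    and subspace_L: "subspace L"
    and L_skew: "L \<subseteq> skew_hermitian"
    and traceless_L: "traceless_skew_hermitian \<subseteq> L"
    and tangent_space: "p \<in> M \<Longrightarrow> tangent_space M p = (**) p ` L"
begin

lemma unitaryD: "p \<in> M \<Longrightarrow> p \<in> unitary_group"
  using unitary by blast

lemma metric: "p \<in> M \<Longrightarrow> left_invariant_metric p v w = v \<bullet> w"
  by (simp add: left_invariant_metric_unitary unitaryD)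

lemma tangent_space_iff:
  assumes "p \<in> M"
  shows "v \<in> tangent_space M p \<longleftrightarrow> conj_transpose p ** v \<in> L"
proof
  show "conj_transpose p ** v \<in> L" if "v \<in> tangent_space M p"
    using that unfolding tangent_space [OF assms]
    by (auto simp: unitary_cancel unitaryD [OF assms])
  show "v \<in> tangent_space M p" if "conj_transpose p ** v \<in> L"
    using imageI [OF that, of "(**) p"] unfolding tangent_space [OF assms]
    by (simp add: unitary_cancel unitaryD [OF assms])
qed

lemma bracket_mem:
  assumes "A \<in> L" "B \<in> L"
  shows "bracket A B \<in> L"
  using assms L_skew traceless_L bracket_skew_hermitian trace_bracket
  unfolding traceless_skew_hermitian_def by blast

lemma skew_part_mem_L: "trace A = 0 \<Longrightarrow> skew_part A \<in> L"
  using traceless_L skew_part_mem trace_skew_part unfolding traceless_skew_hermitian_def by blast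

text \<open>Translation to the identity turns a tangent field into a function with values in the
  fixed subspace \<open>L\<close>; \<open>vector_fieldI\<close> is the converse.\<close>

lemma vector_fieldD:
  assumes "vector_field M Y"
  shows "(\<lambda>x. conj_transpose x ** Y x) differentiable_on M"
    and "x \<in> M \<Longrightarrow> conj_transpose x ** Y x \<in> L"
proof -
  have "(Y has_derivative dir_deriv M Y x) (at x within M)" if "x \<in> M" for x
    using assms that has_derivative_dir_deriv unfolding vector_field_def by blast
  then have "((\<lambda>x. conj_transpose x ** Y x) has_derivative
      (\<lambda>h. conj_transpose x ** dir_deriv M Y x h + conj_transpose h ** Y x)) (at x within M)"
    if "x \<in> M" for x
    using that
    by (intro matrix_mult_has_derivative conj_transpose_has_derivative has_derivative_ident) blast
  then show "(\<lambda>x. conj_transpose x ** Y x) differentiable_on M"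
    unfolding differentiable_on_def differentiable_def by blast
  show "x \<in> M \<Longrightarrow> conj_transpose x ** Y x \<in> L"
    using assms unfolding vector_field_def by (simp add: tangent_space_iff)
qed

lemma vector_fieldI:
  assumes G: "G differentiable_on M" "\<And>x. x \<in> M \<Longrightarrow> G x \<in> L"
    and X: "\<And>x. x \<in> M \<Longrightarrow> X x = x ** G x"
  shows "vector_field M X"
proof -
  have "(X has_derivative (\<lambda>h. x ** dir_deriv M G x h + h ** G x)) (at x within M)" if "x \<in> M" for x
    using X that
    by (intro has_derivative_transform [OF that X] matrix_mult_has_derivative has_derivative_ident
        has_derivative_dir_deriv G)
  then have "X differentiable_on M"
    unfolding differentiable_on_def differentiable_def by blast
  then show ?thesis
    unfolding vector_field_def using G X by (simp add: tangent_space)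
qed

text \<open>The product rule for \<open>x ** (conj_transpose x ** Y x)\<close>, which is
  \<open>Y x\<close> on \<open>M\<close>: one term differentiates the frame, the other the
  coefficients.\<close>

lemma dir_deriv_vector_field:
  assumes "vector_field M Y" "p \<in> M" "v \<in> tangent_space M p"
  shows "dir_deriv M Y p v =
    v ** (conj_transpose p ** Y p) + p ** dir_deriv M (\<lambda>x. conj_transpose x ** Y x) p v"
proof -
  let ?B = "\<lambda>x. conj_transpose x ** Y x"
  have "((\<lambda>x. x ** ?B x) has_derivative (\<lambda>h. p ** dir_deriv M ?B p h + h ** ?B p)) (at p within M)"
    by (intro matrix_mult_has_derivative has_derivative_ident has_derivative_dir_deriv
        vector_fieldD assms)
  then have "dir_deriv M Y p v = p ** dir_deriv M ?B p v + v ** ?B p"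
    by (rule dir_deriv_eq [OF assms(2,3)]) (simp add: unitary_cancel(1) unitaryD)
  then show ?thesis
    by (simp add: add.commute)
qed

text \<open>The metric is bi-invariant, so \<open>\<nabla>\<^sub>A B = [A, B] / 2\<close> on left-invariant fields.\<close>

definition connection ::
  "complex^'n^'n \<Rightarrow> complex^'n^'n \<Rightarrow> (complex^'n^'n \<Rightarrow> complex^'n^'n) \<Rightarrow> complex^'n^'n" where
  "connection p v Y = p ** (dir_deriv M (\<lambda>x. conj_transpose x ** Y x) p v
     + (1/2) *\<^sub>R bracket (conj_transpose p ** v) (conj_transpose p ** Y p))"

lemma bracket_linear_simps:
  "bracket (A + B) C = bracket A C + bracket B C"
  "bracket A (B + C) = bracket A B + bracket A C"
  "bracket (r *\<^sub>R A) B = r *\<^sub>R bracket A B"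
  "bracket A (r *\<^sub>R B) = r *\<^sub>R bracket A B"
  for A B C :: "complex^'n^'n"
  by (simp_all add: bracket_def matrix_mult_linear_simps algebra_simps)

lemma connection_tangent:
  assumes "p \<in> M" "v \<in> tangent_space M p" "vector_field M Y"
  shows "connection p v Y \<in> tangent_space M p"
proof -
  have "dir_deriv M (\<lambda>x. conj_transpose x ** Y x) p v \<in> L"
    by (intro dir_deriv_mem_subspace subspace_L vector_fieldD assms)
  moreover have "conj_transpose p ** v \<in> L"
    using assms by (simp add: tangent_space_iff)
  ultimately show ?thesis
    using vector_fieldD(2) [OF assms(3,1)]
    by (simp add: connection_def tangent_space [OF assms(1)] subspace_add subspace_scale subspace_L
        bracket_mem)
qed

lemma levi_civita_connection: "levi_civita M left_invariant_metric connection"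
  unfolding levi_civita_def
proof (intro conjI ballI allI impI)
  fix p v Y assume "p \<in> M" "v \<in> tangent_space M p" "vector_field M Y"
  then show "connection p v Y \<in> tangent_space M p"
    by (rule connection_tangent)
next
  fix p v w Y and a b :: real
  assume p: "p \<in> M" and "v \<in> tangent_space M p" "w \<in> tangent_space M p" and Y: "vector_field M Y"
  let ?B = "\<lambda>x. conj_transpose x ** Y x"
  have "linear (dir_deriv M ?B p)"
    using has_derivative_bounded_linear [OF has_derivative_dir_deriv [OF vector_fieldD(1) [OF Y] p]]
    by (rule bounded_linear.linear)
  then show "connection p (a *\<^sub>R v + b *\<^sub>R w) Y = a *\<^sub>R connection p v Y + b *\<^sub>R connection p w Y"
    by (simp add: connection_def linear_add linear_scale matrix_mult_linear_simps
        bracket_linear_simps algebra_simps)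
next
  fix p v Y Z
  assume p: "p \<in> M" and v: "v \<in> tangent_space M p" and Y: "vector_field M Y" and Z: "vector_field M Z"
  let ?B = "\<lambda>x. conj_transpose x ** Y x" and ?C = "\<lambda>x. conj_transpose x ** Z x"
  have "dir_deriv M (\<lambda>x. conj_transpose x ** (Y x + Z x)) p v = dir_deriv M ?B p v + dir_deriv M ?C p v"
    by (rule dir_deriv_eq [OF p v has_derivative_add
          [OF has_derivative_dir_deriv [OF vector_fieldD(1) [OF Y] p]
            has_derivative_dir_deriv [OF vector_fieldD(1) [OF Z] p]]])
      (simp add: matrix_mult_linear_simps)
  then show "connection p v (\<lambda>x. Y x + Z x) = connection p v Y + connection p v Z"
    by (simp add: connection_def matrix_mult_linear_simps bracket_linear_simps algebra_simps)
next
  fix p v Y and f :: "complex^'n^'n \<Rightarrow> real"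
  assume p: "p \<in> M" and v: "v \<in> tangent_space M p" and f: "f differentiable_on M"
    and Y: "vector_field M Y"
  let ?B = "\<lambda>x. conj_transpose x ** Y x"
  have "dir_deriv M (\<lambda>x. conj_transpose x ** (f x *\<^sub>R Y x)) p v =
      f p *\<^sub>R dir_deriv M ?B p v + dir_deriv M f p v *\<^sub>R ?B p"
    by (rule dir_deriv_eq [OF p v has_derivative_scaleR
          [OF has_derivative_dir_deriv [OF f p]
            has_derivative_dir_deriv [OF vector_fieldD(1) [OF Y] p]]])
      (simp add: matrix_mult_linear_simps)
  then show "connection p v (\<lambda>x. f x *\<^sub>R Y x) = dir_deriv M f p v *\<^sub>R Y p + f p *\<^sub>R connection p v Y"
    by (simp add: connection_def matrix_mult_linear_simps bracket_linear_simps algebra_simps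
        unitary_cancel(1) [OF unitaryD [OF p]])
next
  fix p X Y
  assume p: "p \<in> M" and X: "vector_field M X" and Y: "vector_field M Y"
  have "X p \<in> tangent_space M p" "Y p \<in> tangent_space M p"
    using X Y p unfolding vector_field_def by auto
  \<comment> \<open>With \<open>A\<close> and \<open>B\<close> the translates of \<open>X p\<close>
    and \<open>Y p\<close>, differentiating the frame contributes \<open>p ** bracket A B\<close> to
    the Lie bracket. The two half brackets of the connection add up to the same.\<close>
  then show "connection p (X p) Y - connection p (Y p) X = lie_bracket M X Y p"
    using unitary_cancel(1) [OF unitaryD [OF p]] unitary_cancel(3) [OF unitaryD [OF p]]
    apply (simp add: lie_bracket_def connection_def dir_deriv_vector_field X Y p bracket_def
        matrix_mult_linear_simps matrix_mul_assoc)
    apply (simp add: algebra_simps flip: scaleR_add_left)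
    done
next
  fix p v Y Z
  assume p: "p \<in> M" and v: "v \<in> tangent_space M p" and Y: "vector_field M Y" and Z: "vector_field M Z"
  let ?B = "\<lambda>x. conj_transpose x ** Y x" and ?C = "\<lambda>x. conj_transpose x ** Z x"
  have adjoint: "(p ** A) \<bullet> w = A \<bullet> (conj_transpose p ** w)" "w \<bullet> (p ** A) = (conj_transpose p ** w) \<bullet> A"
    for A w :: "complex^'n^'n"
    by (simp_all add: inner_matrix_mult_left inner_commute [of w])
  have "dir_deriv M (\<lambda>x. left_invariant_metric x (Y x) (Z x)) p v =
      ?B p \<bullet> dir_deriv M ?C p v + dir_deriv M ?B p v \<bullet> ?C p"
    by (rule dir_deriv_eq [OF p v has_derivative_inner
          [OF has_derivative_dir_deriv [OF vector_fieldD(1) [OF Y] p]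
            has_derivative_dir_deriv [OF vector_fieldD(1) [OF Z] p]]])
      (simp add: metric inner_conj_transpose_unitary_mult unitaryD)
  \<comment> \<open>By this the two half brackets cancel in the metric identity.\<close>
  moreover have "bracket (conj_transpose p ** v) (?B p) \<bullet> ?C p =
      - (?B p \<bullet> bracket (conj_transpose p ** v) (?C p))"
    using v p vector_fieldD(2) [OF Z p] L_skew
    by (intro inner_bracket_skew_hermitian) (auto simp: tangent_space_iff)
  ultimately show "dir_deriv M (\<lambda>x. left_invariant_metric x (Y x) (Z x)) p v =
      left_invariant_metric p (connection p v Y) (Z p) +
      left_invariant_metric p (Y p) (connection p v Z)"
    by (simp add: metric p connection_def adjoint inner_add_left inner_add_right)
qed

lemma left_invariant_vector_field:
  assumes "A \<in> L"
  shows "vector_field M (\<lambda>x. x ** A)"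
  by (rule vector_fieldI [where G = "\<lambda>x. A"]) (use assms in auto)

text \<open>The difference of two Levi-Civita connections is symmetric in its two arguments, by
  torsion-freeness, and skew-adjoint in the second one, by metricity; hence it vanishes.\<close>

lemma levi_civita_unique:
  assumes D: "levi_civita M left_invariant_metric D"
    and p: "p \<in> M" and v: "v \<in> tangent_space M p" and Y: "vector_field M Y"
  shows "D p v Y = connection p v Y"
proof -
  define S where "S X Z = D p (X p) Z - connection p (X p) Z" for X Z
  \<comment> \<open>\<open>S\<close> takes fields as arguments; left-invariant fields realise every
    tangent vector at \<open>p\<close>.\<close>
  have field: "\<exists>X. vector_field M X \<and> X p = w" if "w \<in> tangent_space M p" for w
    using that left_invariant_vector_field unfolding tangent_space [OF p] by blast
  have at_p: "X p \<in> tangent_space M p" if "vector_field M X" for X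
    using that p unfolding vector_field_def by blast
  have sym: "S X Z = S Z X" if "vector_field M X" "vector_field M Z" for X Z
  proof -
    have "D p (X p) Z - D p (Z p) X = connection p (X p) Z - connection p (Z p) X"
      using D levi_civita_connection that p unfolding levi_civita_def by simp
    then show ?thesis
      by (simp add: S_def algebra_simps)
  qed
  have skew: "S X Z \<bullet> W p = - (S X W \<bullet> Z p)"
    if X: "vector_field M X" and Z: "vector_field M Z" and W: "vector_field M W" for X Z W
  proof -
    have compat: "dir_deriv M (\<lambda>x. left_invariant_metric x (Z x) (W x)) p (X p) =
        D' p (X p) Z \<bullet> W p + Z p \<bullet> D' p (X p) W" if "levi_civita M left_invariant_metric D'" for D'
      using that at_p [OF X] Z W p unfolding levi_civita_def by (simp add: metric [OF p])
    show ?thesis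
      using compat [OF D] compat [OF levi_civita_connection]
      by (simp add: S_def inner_diff_left inner_commute [of "Z p"])
  qed
  obtain X where X: "vector_field M X" "X p = v"
    using field [OF v] by blast
  have "D p v Y \<in> tangent_space M p"
    using D p v Y unfolding levi_civita_def by simp
  then have "S X Y \<in> tangent_space M p"
    using connection_tangent [OF p v Y] X(2) subspace_L
    by (simp add: S_def tangent_space_iff [OF p] matrix_mult_linear_simps subspace_diff)
  \<comment> \<open>With this test field, alternating symmetry and skewness leads from the squared
    norm of \<open>S X Y\<close> back to its negative.\<close>
  then obtain W where W: "vector_field M W" "W p = S X Y"
    using field by blast
  have "S X Y \<bullet> W p = - (S X W \<bullet> Y p)"
    by (rule skew [OF X(1) Y W(1)])
  also have "\<dots> = S W Y \<bullet> X p"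
    by (simp add: sym [OF X(1) W(1)] skew [OF W(1) X(1) Y])
  also have "\<dots> = - (S Y X \<bullet> W p)"
    by (simp add: sym [OF W(1) Y] skew [OF Y W(1) X(1)])
  also have "\<dots> = - (S X Y \<bullet> W p)"
    by (simp add: sym [OF X(1) Y])
  finally show ?thesis
    by (simp add: W(2) S_def X(2))
qed

section \<open>Orthonormal frames, divergence and gradient\<close>

definition frame :: "complex^'n^'n \<Rightarrow> (complex^'n^'n) set" where
  "frame p = (**) (conj_transpose p) ` (SOME B. orthonormal_tangent_basis M left_invariant_metric p B)"

context
  fixes p assumes p: "p \<in> M"
begin

text \<open>Tangent spaces are linear subspaces, so the choice made in \<open>divergence\<close> and
  \<open>frame\<close> yields a genuine orthonormal basis.\<close>

lemma orthonormal_tangent_basis_some: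
  "orthonormal_tangent_basis M left_invariant_metric p
     (SOME B. orthonormal_tangent_basis M left_invariant_metric p B)"
proof -
  have "subspace (tangent_space M p)"
    unfolding tangent_space [OF p]
    by (intro linear_subspace_image subspace_L bounded_linear.linear bounded_linear_matrix_mult_left)
  then obtain B where B: "pairwise orthogonal B" "\<And>x. x \<in> B \<Longrightarrow> norm x = 1" "independent B"
      "span B = tangent_space M p"
    using orthonormal_basis_subspace by metis
  have "orthonormal_tangent_basis M left_invariant_metric p B"
    unfolding orthonormal_tangent_basis_def metric [OF p]
    using B independent_imp_finite by (auto simp: pairwise_def orthogonal_def norm_eq_1)
  then show ?thesis
    by (rule someI)
qed

lemma inj_on_frame: "inj_on ((**) (conj_transpose p)) A" for A :: "(complex^'n^'n) set"
  by (metis inj_onI unitary_cancel(1) unitaryD [OF p])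

lemma finite_frame: "finite (frame p)"
  using orthonormal_tangent_basisD(1) [OF orthonormal_tangent_basis_some] by (simp add: frame_def)

lemma span_frame: "span (frame p) = L"
proof -
  have "span (frame p) = (**) (conj_transpose p) ` tangent_space M p"
    unfolding frame_def orthonormal_tangent_basisD(2) [OF orthonormal_tangent_basis_some, symmetric]
    by (intro linear_span_image bounded_linear.linear bounded_linear_matrix_mult_left)
  then show ?thesis
    unfolding tangent_space [OF p] by (simp add: image_image unitary_cancel unitaryD [OF p])
qed

lemma orthonormal_frame:
  assumes "E \<in> frame p" "F \<in> frame p"
  shows "E \<bullet> F = (if E = F then 1 else 0)"
proof -
  obtain v w where v: "v \<in> (SOME B. orthonormal_tangent_basis M left_invariant_metric p B)"
      "E = conj_transpose p ** v"
    and w: "w \<in> (SOME B. orthonormal_tangent_basis M left_invariant_metric p B)"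
      "F = conj_transpose p ** w"
    using assms unfolding frame_def by blast
  have "E = F \<longleftrightarrow> v = w"
    unfolding v w by (metis unitary_cancel(1) unitaryD [OF p])
  moreover have "E \<bullet> F = v \<bullet> w"
    unfolding v w by (rule inner_conj_transpose_unitary_mult [OF unitaryD [OF p]])
  ultimately show ?thesis
    using orthonormal_tangent_basisD(3) [OF orthonormal_tangent_basis_some v(1) w(1)]
    by (simp add: metric [OF p])
qed

text \<open>Expand \<open>B\<close> in the frame and pair with \<open>A\<close>, which may lie
  outside \<open>L\<close>.\<close>

lemma parseval:
  assumes "B \<in> L"
  shows "(\<Sum>E\<in>frame p. (A \<bullet> E) * (B \<bullet> E)) = A \<bullet> B"
proof -
  have "(\<Sum>E\<in>frame p. (B \<bullet> E) *\<^sub>R E) = B"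
    using assms orthonormal_frame
    by (intro orthonormal_basis_expand)
      (auto simp: pairwise_def orthogonal_def norm_eq_1 span_frame finite_frame)
  then have "A \<bullet> B = A \<bullet> (\<Sum>E\<in>frame p. (B \<bullet> E) *\<^sub>R E)"
    by simp
  then show ?thesis
    by (simp add: inner_sum_right mult.commute)
qed

text \<open>By uniqueness the chosen connection acts on \<open>X\<close> as
  \<open>connection\<close>. Its bracket term drops out since
  \<open>bracket E B \<bullet> E = - (B \<bullet> bracket E E) = 0\<close>.\<close>

lemma divergence_eq:
  assumes G: "G differentiable_on M" "\<And>x. x \<in> M \<Longrightarrow> G x \<in> L"
    and X: "\<And>x. x \<in> M \<Longrightarrow> X x = x ** G x"
  shows "divergence M left_invariant_metric X p = (\<Sum>E\<in>frame p. dir_deriv M G p (p ** E) \<bullet> E)"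
proof -
  let ?B = "SOME B. orthonormal_tangent_basis M left_invariant_metric p B"
  let ?D = "SOME D. levi_civita M left_invariant_metric D"
  have X': "vector_field M X"
    by (rule vector_fieldI [OF G X])
  have "levi_civita M left_invariant_metric ?D"
    using levi_civita_connection by (rule someI [of "levi_civita M left_invariant_metric"])
  then have D: "?D p e X = connection p e X" if "e \<in> tangent_space M p" for e
    using levi_civita_unique p that X' by blast
  have "left_invariant_metric p (?D p e X) e =
      dir_deriv M G p (p ** (conj_transpose p ** e)) \<bullet> (conj_transpose p ** e)" if "e \<in> ?B" for e
  proof -
    have e: "e \<in> tangent_space M p"
      using that orthonormal_tangent_basisD(2) [OF orthonormal_tangent_basis_some] span_base
      by blast
    then have E: "conj_transpose p ** e \<in> skew_hermitian"
      using tangent_space_iff [OF p] L_skew by blast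
    have "dir_deriv M (\<lambda>x. conj_transpose x ** X x) p e = dir_deriv M G p e"
      using p by (intro dir_deriv_eq [OF p e has_derivative_dir_deriv [OF G(1)]])
        (simp_all add: X unitary_cancel unitaryD)
    moreover have "bracket (conj_transpose p ** e) B \<bullet> (conj_transpose p ** e) = 0" for B
      by (simp add: inner_bracket_skew_hermitian E) (simp add: bracket_def)
    ultimately show ?thesis
      by (simp add: D [OF e] metric [OF p] connection_def inner_matrix_mult_left [of p]
          inner_add_left unitary_cancel(1) [OF unitaryD [OF p]])
  qed
  then show ?thesis
    unfolding divergence_def Let_def frame_def
    by (simp add: sum.reindex [OF inj_on_frame])
qed

text \<open>For uniqueness, which the definite description requires, test with the tangent vector
  \<open>v - p ** A\<close>.\<close>

lemma gradient_eq:
  assumes "A \<in> L" and A: "\<And>E. E \<in> L \<Longrightarrow> A \<bullet> E = dir_deriv M f p (p ** E)"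
  shows "gradient M left_invariant_metric f p = p ** A"
  unfolding gradient_def
proof (rule the_equality)
  show *: "p ** A \<in> tangent_space M p \<and>
      (\<forall>w\<in>tangent_space M p. left_invariant_metric p (p ** A) w = dir_deriv M f p w)"
    using assms by (auto simp: tangent_space p metric inner_unitary_mult unitaryD)
  fix v assume v: "v \<in> tangent_space M p \<and>
      (\<forall>w\<in>tangent_space M p. left_invariant_metric p v w = dir_deriv M f p w)"
  have "v - p ** A \<in> tangent_space M p"
    using v * subspace_L by (simp add: tangent_space_iff p matrix_mult_linear_simps subspace_diff)
  then have "v \<bullet> (v - p ** A) = (p ** A) \<bullet> (v - p ** A)"
    using v * by (simp add: metric p)
  then have "(v - p ** A) \<bullet> (v - p ** A) = 0"
    by (simp add: inner_diff_left)
  then show "v = p ** A"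
    by simp
qed

end

text \<open>\<open>differential_matrix f N\<close> says that \<open>- N\<close> is the complexified gradient of \<open>f\<close> in the
  left-invariant frame, the complex bilinear form being \<open>(A, B) \<mapsto> - tr (A B)\<close>.\<close>

definition differential_matrix ::
  "(complex^'n^'n \<Rightarrow> complex) \<Rightarrow> (complex^'n^'n \<Rightarrow> complex^'n^'n) \<Rightarrow> bool" where
  "differential_matrix f N \<longleftrightarrow> N differentiable_on M \<and> (\<forall>p\<in>M. trace (N p) = 0) \<and>
     (\<forall>p\<in>M. \<exists>f'. (f has_derivative f') (at p within M) \<and> (\<forall>E\<in>L. f' (p ** E) = trace (E ** N p)))"

context
  fixes f N assumes f: "differential_matrix f N"
begin

lemma differential_matrixD:
  assumes "p \<in> M"
  shows "N differentiable_on M" "trace (N p) = 0"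
    "skew_part (N p) \<in> L" "skew_part (mat \<i> ** N p) \<in> L"
  using f assms unfolding differential_matrix_def
  by (auto intro!: skew_part_mem_L simp: trace_mat_mult)

text \<open>Compare with \<open>trace_mult_skew_hermitian\<close>. Vanishing of
  \<open>trace (N p)\<close> puts both candidates in \<open>L\<close>, also when \<open>L\<close>
  has only traceless elements.\<close>

lemma gradient_Re_Im:
  assumes p: "p \<in> M"
  shows "gradient M left_invariant_metric (\<lambda>x. Re (f x)) p = p ** (- skew_part (N p))"
    and "gradient M left_invariant_metric (\<lambda>x. Im (f x)) p = p ** skew_part (mat \<i> ** N p)"
proof -
  obtain f' where f': "(f has_derivative f') (at p within M)" "\<And>E. E \<in> L \<Longrightarrow> f' (p ** E) = trace (E ** N p)"
    using f p unfolding differential_matrix_def by blast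
  have E: "E \<in> skew_hermitian" "p ** E \<in> tangent_space M p" if "E \<in> L" for E
    using that L_skew tangent_space [OF p] by auto
  have "dir_deriv M (\<lambda>x. Re (f x)) p (p ** E) = Re (f' (p ** E))"
    "dir_deriv M (\<lambda>x. Im (f x)) p (p ** E) = Im (f' (p ** E))" if "E \<in> L" for E
    by (intro dir_deriv_eq [OF p E(2) [OF that] bounded_linear.has_derivative
          [OF bounded_linear_Re f'(1)] refl]
        dir_deriv_eq [OF p E(2) [OF that] bounded_linear.has_derivative
          [OF bounded_linear_Im f'(1)] refl])+
  then show "gradient M left_invariant_metric (\<lambda>x. Re (f x)) p = p ** (- skew_part (N p))"
    "gradient M left_invariant_metric (\<lambda>x. Im (f x)) p = p ** skew_part (mat \<i> ** N p)"
    using differential_matrixD [OF p]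
    by (auto intro!: gradient_eq [OF p] subspace_neg subspace_L
        simp: f'(2) trace_mult_skew_hermitian E(1))
qed

lemma gradient_frame_differentiable:
  "(\<lambda>x. - skew_part (N x)) differentiable_on M"
  "(\<lambda>x. skew_part (mat \<i> ** N x)) differentiable_on M"
  "p \<in> M \<Longrightarrow> v \<in> tangent_space M p \<Longrightarrow>
    dir_deriv M (\<lambda>x. - skew_part (N x)) p v = - skew_part (dir_deriv M N p v)"
  "p \<in> M \<Longrightarrow> v \<in> tangent_space M p \<Longrightarrow>
    dir_deriv M (\<lambda>x. skew_part (mat \<i> ** N x)) p v = skew_part (mat \<i> ** dir_deriv M N p v)"
proof -
  have S: "bounded_linear (skew_part :: complex^'n^'n \<Rightarrow> _)"
    using linear_skew_part linear_conv_bounded_linear by blast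
  have N: "(N has_derivative dir_deriv M N x) (at x within M)" if "x \<in> M" for x
    using has_derivative_dir_deriv differential_matrixD that by blast
  have 1: "((\<lambda>x. - skew_part (N x)) has_derivative (\<lambda>h. - skew_part (dir_deriv M N x h))) (at x within M)"
    if "x \<in> M" for x
    by (intro has_derivative_minus bounded_linear.has_derivative [OF S] N that)
  have 2: "((\<lambda>x. skew_part (mat \<i> ** N x)) has_derivative
      (\<lambda>h. skew_part (mat \<i> ** dir_deriv M N x h))) (at x within M)" if "x \<in> M" for x
    by (intro bounded_linear.has_derivative [OF S] N that
        bounded_linear.has_derivative [OF bounded_linear_matrix_mult_left])
  show "(\<lambda>x. - skew_part (N x)) differentiable_on M"
    "(\<lambda>x. skew_part (mat \<i> ** N x)) differentiable_on M"
    unfolding differentiable_on_def differentiable_def using 1 2 by blast+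
  assume p: "p \<in> M" and v: "v \<in> tangent_space M p"
  show "dir_deriv M (\<lambda>x. - skew_part (N x)) p v = - skew_part (dir_deriv M N p v)"
    by (rule dir_deriv_eq [OF p v 1 [OF p]]) simp
  show "dir_deriv M (\<lambda>x. skew_part (mat \<i> ** N x)) p v = skew_part (mat \<i> ** dir_deriv M N p v)"
    by (rule dir_deriv_eq [OF p v 2 [OF p]]) simp
qed

lemma twice_differentiable: "twice_differentiable_on_submanifold M left_invariant_metric f"
  unfolding twice_differentiable_on_submanifold_def
proof (intro conjI)
  show "f differentiable_on M"
    using f unfolding differential_matrix_def differentiable_on_def differentiable_def by blast
  show "vector_field M (gradient M left_invariant_metric (\<lambda>x. Re (f x)))"
    by (rule vector_fieldI [OF gradient_frame_differentiable(1)])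
      (simp_all add: gradient_Re_Im differential_matrixD subspace_neg subspace_L)
  show "vector_field M (gradient M left_invariant_metric (\<lambda>x. Im (f x)))"
    by (rule vector_fieldI [OF gradient_frame_differentiable(2)])
      (simp_all add: gradient_Re_Im differential_matrixD)
qed

text \<open>Differentiation commutes with the real-linear map \<open>skew_part\<close>; the two real
  divergences then recombine into one complex sum.\<close>

lemma tension_field_eq:
  assumes p: "p \<in> M"
  shows "tension_field M left_invariant_metric f p =
    (\<Sum>E\<in>frame p. trace (E ** dir_deriv M N p (p ** E)))"
proof -
  have E: "E \<in> skew_hermitian" "p ** E \<in> tangent_space M p" if "E \<in> frame p" for E
    using that span_frame [OF p] span_base L_skew tangent_space [OF p] by blast+
  have "divergence M left_invariant_metric (gradient M left_invariant_metric (\<lambda>x. Re (f x))) p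
      = (\<Sum>E\<in>frame p. Re (trace (E ** dir_deriv M N p (p ** E))))"
    using p by (subst divergence_eq [OF p gradient_frame_differentiable(1)])
      (auto simp: gradient_Re_Im differential_matrixD subspace_neg subspace_L E
        gradient_frame_differentiable trace_mult_skew_hermitian)
  moreover have "divergence M left_invariant_metric (gradient M left_invariant_metric (\<lambda>x. Im (f x))) p
      = (\<Sum>E\<in>frame p. Im (trace (E ** dir_deriv M N p (p ** E))))"
    using p by (subst divergence_eq [OF p gradient_frame_differentiable(2)])
      (auto simp: gradient_Re_Im differential_matrixD E
        gradient_frame_differentiable trace_mult_skew_hermitian)
  ultimately show ?thesis
    by (simp add: tension_field_def complex_eq_iff)
qed

end

section \<open>The conformality operator and the Casimir identity\<close>

lemma trace_mult_skew_parts: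
  "trace (Z ** W) = Complex
     (skew_part (mat \<i> ** Z) \<bullet> skew_part (mat \<i> ** W) - skew_part Z \<bullet> skew_part W)
     (skew_part Z \<bullet> skew_part (mat \<i> ** W) + skew_part (mat \<i> ** Z) \<bullet> skew_part W)"
  for Z W :: "complex^'n^'n"
proof -
  \<comment> \<open>This is the splitting of \<open>Z\<close> into a skew-Hermitian matrix and
    \<open>\<i>\<close> times another one.\<close>
  have "mat \<i> ** skew_part (mat \<i> ** Z) = skew_part Z - Z"
    by (simp add: skew_part_def vec_eq_iff mat_mult_nth conj_transpose_def)
      (simp add: complex_eq_iff field_simps)
  then have "trace (Z ** W) = trace (skew_part Z ** W) - \<i> * trace (skew_part (mat \<i> ** Z) ** W)"
    by (metis (no_types, lifting) diff_diff_eq2 add_diff_cancel_left' matrix_mul_assoc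
        matrix_mult_linear_simps(3) trace_linear_simps(2) trace_mat_mult)
  then show ?thesis
    by (simp add: trace_mult_skew_hermitian skew_part_mem complex_eq_iff inner_commute)
qed

lemma conformality_eq:
  assumes "differential_matrix f N" "differential_matrix h K" "p \<in> M"
  shows "conformality M left_invariant_metric f h p = - trace (N p ** K p)"
  using assms
  by (simp add: conformality_def Let_def gradient_Re_Im metric inner_unitary_mult unitaryD
      trace_mult_skew_parts complex_eq_iff inner_minus_left inner_minus_right)

text \<open>The Casimir identity: for \<open>W\<close> of trace zero, \<open>\<Sum> E \<otimes> E\<close> acts as the flip up to sign, whether
  or not \<open>L\<close> contains the scalars.\<close>

lemma sum_frame_trace_mult_trace:
  assumes p: "p \<in> M" and W: "trace W = 0"
  shows "(\<Sum>E\<in>frame p. trace (E ** Z) * trace (E ** W)) = - trace (Z ** W)"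
proof -
  have E: "E \<in> skew_hermitian" if "E \<in> frame p" for E
    using that span_frame [OF p] span_base L_skew by blast
  have "trace (E ** Z) * trace (E ** W) = Complex
      ((skew_part Z \<bullet> E) * (skew_part W \<bullet> E)
        - (skew_part (mat \<i> ** Z) \<bullet> E) * (skew_part (mat \<i> ** W) \<bullet> E))
      (- ((skew_part Z \<bullet> E) * (skew_part (mat \<i> ** W) \<bullet> E))
        - (skew_part (mat \<i> ** Z) \<bullet> E) * (skew_part W \<bullet> E))" if "E \<in> frame p" for E
    using E [OF that] by (simp add: trace_mult_skew_hermitian complex_eq_iff)
  \<comment> \<open>\<open>parseval\<close> asks for one factor in \<open>L\<close>; in every
    product it is the one that comes from the traceless \<open>W\<close>.\<close>
  moreover have "skew_part W \<in> L" "skew_part (mat \<i> ** W) \<in> L"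
    using W by (auto intro!: skew_part_mem_L simp: trace_mat_mult)
  ultimately show ?thesis
    by (simp add: complex_eq_iff sum_subtractf sum_negf parseval [OF p] trace_mult_skew_parts)
qed

end

section \<open>Quotients of the functions \<open>Q\<close>\<close>

text \<open>Column times row without conjugation, so that it is complex bilinear.\<close>

definition outer :: "complex^'n \<Rightarrow> complex^'n \<Rightarrow> complex^'n^'n" where
  "outer u v = (\<chi> l k. u $ l * v $ k)"

lemma trace_outer: "trace (outer u v) = (\<Sum>k\<in>UNIV. u $ k * v $ k)"
  by (simp add: trace_def outer_def)

lemma trace_mult_outer: "trace (E ** outer u v) = (\<Sum>l\<in>UNIV. (\<Sum>k\<in>UNIV. v $ k * E $ k $ l) * u $ l)"
  unfolding trace_def matrix_matrix_mult_def outer_def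
  by (simp add: sum_distrib_right) (subst sum.swap, simp add: ac_simps)

lemma trace_outer_mult_outer:
  "trace (outer u v ** outer u' v') = (\<Sum>k\<in>UNIV. v $ k * u' $ k) * (\<Sum>k\<in>UNIV. v' $ k * u $ k)"
  unfolding trace_def matrix_matrix_mult_def outer_def
  by (simp add: sum_product ac_simps)

lemma sum_mult_axis: "(\<Sum>k\<in>UNIV. f k * axis i (1::complex) $ k) = f i"
  by (simp add: axis_def if_distrib [of "\<lambda>x. y * x" for y] cong: if_cong)

lemma sum_axis_mult: "(\<Sum>k\<in>UNIV. axis i (1::complex) $ k * f k) = f i"
  using sum_mult_axis [of f i] by (simp add: mult.commute)

lemma has_derivative_vec:
  fixes f :: "'a::real_normed_vector \<Rightarrow> 'b::euclidean_space^'n"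
  assumes "\<And>i. ((\<lambda>x. f x $ i) has_derivative (\<lambda>h. f' h $ i)) (at a within S)"
  shows "(f has_derivative f') (at a within S)"
  unfolding has_derivative_componentwise_within [of f f' a S]
  by (auto simp: Basis_vec_def inner_axis intro!: has_derivative_inner_left assms)

text \<open>Multiplying \<open>p\<close> on the right by \<open>E\<close> multiplies the row of the
  \<open>Q q k p\<close> by \<open>E\<close>; the vector \<open>q\<close> then matters only through
  that row.\<close>

lemma Q_mult: "Q q k (p ** E) = (\<Sum>j\<in>UNIV. Q q j p * E $ j $ k)"
  unfolding Q_def matrix_matrix_mult_def
  by (simp add: sum_distrib_left sum_distrib_right mult.assoc) (rule sum.swap)

lemma bounded_linear_Q: "bounded_linear (Q q k)"
proof -
  have "linear (Q q k)"
    by (auto intro!: linearI simp: Q_def algebra_simps sum.distrib scaleR_sum_right)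
  then show ?thesis
    by (simp add: linear_conv_bounded_linear)
qed

lemmas Q_has_derivative [derivative_intros] =
  bounded_linear.has_derivative [OF bounded_linear_Q has_derivative_ident]

text \<open>Writing \<open>a\<close> for the row vector of the \<open>Q\<^sub>k\<close>, the differential of \<open>Q\<^sub>\<alpha> / Q\<^sub>\<beta>\<close> at \<open>p\<close> is
  \<open>p E \<mapsto> a E c\<close> with \<open>c\<close> the gradient of \<open>a\<^sub>\<alpha> / a\<^sub>\<beta>\<close> with respect to \<open>a\<close>; homogeneity of degree zero
  gives \<open>a c = 0\<close>.\<close>

definition Q_row :: "complex^'n \<Rightarrow> complex^'n^'n \<Rightarrow> complex^'n" where
  "Q_row q x = (\<chi> k. Q q k x)"

definition quotient_column :: "complex^'n \<Rightarrow> 'n \<Rightarrow> 'n \<Rightarrow> complex^'n^'n \<Rightarrow> complex^'n" where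
  "quotient_column q \<alpha> \<beta> x = (\<chi> l. (if l = \<alpha> then 1 / Q q \<beta> x else 0)
     - (if l = \<beta> then Q q \<alpha> x / (Q q \<beta> x)\<^sup>2 else 0))"

text \<open>The differential of \<open>quotient_column\<close> at \<open>x\<close>; as
  \<open>Q\<close> is linear, \<open>Q q \<alpha> h\<close> is its own differential in the direction
  \<open>h\<close>.\<close>

definition quotient_column_derivative ::
  "complex^'n \<Rightarrow> 'n \<Rightarrow> 'n \<Rightarrow> complex^'n^'n \<Rightarrow> complex^'n^'n \<Rightarrow> complex^'n" where
  "quotient_column_derivative q \<alpha> \<beta> x h = (\<chi> l. (if l = \<alpha> then - (Q q \<beta> h / (Q q \<beta> x)\<^sup>2) else 0)
     - (if l = \<beta> then Q q \<alpha> h / (Q q \<beta> x)\<^sup>2 - 2 * Q q \<alpha> x * Q q \<beta> h / (Q q \<beta> x)^3 else 0))"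

lemma sum_mult_quotient_column:
  "(\<Sum>k\<in>UNIV. v $ k * quotient_column q \<alpha> \<beta> x $ k)
     = v $ \<alpha> / Q q \<beta> x - v $ \<beta> * Q q \<alpha> x / (Q q \<beta> x)\<^sup>2"
  by (simp add: quotient_column_def right_diff_distrib sum_subtractf
      if_distrib [of "\<lambda>x. y * x" for y] cong: if_cong)

lemma sum_mult_quotient_column_derivative:
  "(\<Sum>k\<in>UNIV. v $ k * quotient_column_derivative q \<alpha> \<beta> x h $ k)
     = - (v $ \<alpha> * Q q \<beta> h / (Q q \<beta> x)\<^sup>2)
       - v $ \<beta> * (Q q \<alpha> h / (Q q \<beta> x)\<^sup>2 - 2 * Q q \<alpha> x * Q q \<beta> h / (Q q \<beta> x)^3)"
  by (simp add: quotient_column_derivative_def right_diff_distrib sum_subtractf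
      if_distrib [of "\<lambda>x. y * x" for y] cong: if_cong)

lemma Q_row_quotient_column:
  assumes "Q q \<beta> x \<noteq> 0"
  shows "(\<Sum>k\<in>UNIV. Q_row q x $ k * quotient_column q \<alpha> \<beta> x $ k) = 0"
  unfolding sum_mult_quotient_column using assms by (simp add: Q_row_def power2_eq_square)

lemma outer_quotient_column_has_derivative:
  assumes "Q q \<beta> p \<noteq> 0"
  shows "((\<lambda>x. outer (quotient_column q \<alpha> \<beta> x) (Q_row q x)) has_derivative
    (\<lambda>h. outer (quotient_column q \<alpha> \<beta> p) (Q_row q h)
       + outer (quotient_column_derivative q \<alpha> \<beta> p h) (Q_row q p))) (at p within S)"
proof (intro has_derivative_vec)
  fix l k
  have "((\<lambda>x. 1 / Q q \<beta> x) has_derivative (\<lambda>h. - (Q q \<beta> h / (Q q \<beta> p)\<^sup>2))) (at p within S)"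
    using assms by (auto intro!: derivative_eq_intros simp: fun_eq_iff field_simps power2_eq_square)
  then have 1: "((\<lambda>x. if l = \<alpha> then 1 / Q q \<beta> x else 0) has_derivative
      (\<lambda>h. if l = \<alpha> then - (Q q \<beta> h / (Q q \<beta> p)\<^sup>2) else 0)) (at p within S)"
    by (cases "l = \<alpha>") simp_all
  have "((\<lambda>x. Q q \<alpha> x / (Q q \<beta> x)\<^sup>2) has_derivative (\<lambda>h. Q q \<alpha> h / (Q q \<beta> p)\<^sup>2
      - 2 * Q q \<alpha> p * Q q \<beta> h / (Q q \<beta> p)^3)) (at p within S)"
    using assms
    by (auto intro!: derivative_eq_intros
        simp: fun_eq_iff field_simps power2_eq_square power3_eq_cube)
  then have 2: "((\<lambda>x. if l = \<beta> then Q q \<alpha> x / (Q q \<beta> x)\<^sup>2 else 0) has_derivative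
      (\<lambda>h. if l = \<beta> then Q q \<alpha> h / (Q q \<beta> p)\<^sup>2 - 2 * Q q \<alpha> p * Q q \<beta> h / (Q q \<beta> p)^3 else 0))
      (at p within S)"
    by (cases "l = \<beta>") simp_all
  have "((\<lambda>x. quotient_column q \<alpha> \<beta> x $ l) has_derivative
      (\<lambda>h. quotient_column_derivative q \<alpha> \<beta> p h $ l)) (at p within S)"
    unfolding quotient_column_def quotient_column_derivative_def vec_lambda_beta
    by (rule has_derivative_diff [OF 1 2])
  from has_derivative_mult [OF this Q_has_derivative [of q k]]
  show "((\<lambda>x. outer (quotient_column q \<alpha> \<beta> x) (Q_row q x) $ l $ k) has_derivative
      (\<lambda>h. (outer (quotient_column q \<alpha> \<beta> p) (Q_row q h)
       + outer (quotient_column_derivative q \<alpha> \<beta> p h) (Q_row q p)) $ l $ k)) (at p within S)"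
    by (simp add: outer_def Q_row_def)
qed

section \<open>Harmonicity and orthogonality of the quotients\<close>

context unitary_submanifold
begin

text \<open>The matrix is the column \<open>c\<close> times the row \<open>a\<close>, so its trace
  is \<open>a c\<close>, which vanishes by homogeneity of degree zero.\<close>

lemma differential_matrix_quotient:
  assumes "M \<subseteq> Q_domain q"
  shows "differential_matrix (\<lambda>z. Q q \<alpha> z / Q q \<beta> z) (\<lambda>x. outer (quotient_column q \<alpha> \<beta> x) (Q_row q x))"
  unfolding differential_matrix_def
proof (intro conjI ballI)
  have nonzero: "Q q \<beta> p \<noteq> 0" if "p \<in> M" for p
    using assms that unfolding Q_domain_def by blast
  show "(\<lambda>x. outer (quotient_column q \<alpha> \<beta> x) (Q_row q x)) differentiable_on M"
    unfolding differentiable_on_def differentiable_def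
    using outer_quotient_column_has_derivative [OF nonzero] by blast
  fix p assume "p \<in> M"
  then have p: "Q q \<beta> p \<noteq> 0"
    by (rule nonzero)
  show "trace (outer (quotient_column q \<alpha> \<beta> p) (Q_row q p)) = 0"
    using Q_row_quotient_column [OF p] by (simp add: trace_outer mult.commute)
  have "((\<lambda>z. Q q \<alpha> z / Q q \<beta> z) has_derivative
      (\<lambda>h. Q q \<alpha> h / Q q \<beta> p - Q q \<beta> h * Q q \<alpha> p / (Q q \<beta> p)\<^sup>2)) (at p within M)"
    using p by (auto intro!: derivative_eq_intros simp: fun_eq_iff field_simps power2_eq_square)
  moreover have "Q q \<alpha> (p ** E) / Q q \<beta> p - Q q \<beta> (p ** E) * Q q \<alpha> p / (Q q \<beta> p)\<^sup>2 =
      trace (E ** outer (quotient_column q \<alpha> \<beta> p) (Q_row q p))" for E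
    using sum_mult_quotient_column [of "Q_row q (p ** E)" q \<alpha> \<beta> p]
    by (simp add: trace_mult_outer Q_row_def Q_mult)
  ultimately show "\<exists>f'. ((\<lambda>z. Q q \<alpha> z / Q q \<beta> z) has_derivative f') (at p within M) \<and>
      (\<forall>E\<in>L. f' (p ** E) = trace (E ** outer (quotient_column q \<alpha> \<beta> p) (Q_row q p)))"
    by blast
qed

text \<open>The vanishing of \<open>\<Sum> a E E c\<close>: the Casimir element \<open>\<Sum> E E\<close> is scalar and \<open>a c = 0\<close>.\<close>

lemma sum_frame_trace_square:
  assumes p: "p \<in> M" and ac: "(\<Sum>k\<in>UNIV. a $ k * c $ k) = 0"
  shows "(\<Sum>E\<in>frame p. \<Sum>k\<in>UNIV. trace (E ** outer (axis k 1) a) * trace (E ** outer c (axis k 1))) = 0"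
proof -
  let ?n = "of_nat CARD('n) :: complex"
  \<comment> \<open>The Casimir identity needs a traceless factor, so the scalar part of
    \<open>outer c (axis k 1)\<close> is split off and treated separately.\<close>
  define W where "W k = outer c (axis k 1) - mat (c $ k / ?n)" for k
  have trW: "trace (W k) = 0" for k
    by (simp add: W_def trace_linear_simps trace_outer sum_mult_axis) (simp add: trace_def mat_def)
  have trE: "trace (E ** mat x) = x * trace E" for E :: "complex^'n^'n" and x
    by (simp add: mat_mult_commute [symmetric] trace_mat_mult)
  have split: "trace (E ** outer c (axis k 1)) = trace (E ** W k) + c $ k / ?n * trace E" for E k
    by (simp add: W_def matrix_mult_linear_simps trace_linear_simps trE)
  have "(\<Sum>E\<in>frame p. \<Sum>k\<in>UNIV. trace (E ** outer (axis k 1) a) * trace (E ** W k))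
      = (\<Sum>k\<in>UNIV. \<Sum>E\<in>frame p. trace (E ** outer (axis k 1) a) * trace (E ** W k))"
    by (rule sum.swap)
  also have "\<dots> = (\<Sum>k\<in>UNIV. - trace (outer (axis k 1) a ** W k))"
    by (simp add: sum_frame_trace_mult_trace p trW)
  \<comment> \<open>The rank-one part of \<open>W k\<close> contributes a multiple of
    \<open>a c = 0\<close>; only the scalar correction is left.\<close>
  also have "\<dots> = (\<Sum>k\<in>UNIV. a $ k * c $ k / ?n)"
    by (simp add: W_def matrix_mult_linear_simps trace_linear_simps trE trace_outer_mult_outer
        trace_outer sum_axis_mult sum_mult_axis ac mult.commute)
  also have "\<dots> = 0"
    by (simp add: ac flip: sum_divide_distrib)
  finally have 1: "(\<Sum>E\<in>frame p. \<Sum>k\<in>UNIV. trace (E ** outer (axis k 1) a) * trace (E ** W k)) = 0" .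
  have axis: "trace (E ** outer (axis k 1) a) = (\<Sum>j\<in>UNIV. a $ j * E $ j $ k)" for E k
    by (simp add: trace_mult_outer sum_mult_axis)
  \<comment> \<open>Writing \<open>trace E\<close> with \<open>mat 1\<close> brings the scalar parts
    into the form of the Casimir identity, with the traceless factor
    \<open>outer c a\<close>.\<close>
  have "(\<Sum>k\<in>UNIV. trace (E ** outer (axis k 1) a) * (c $ k / ?n * trace E))
      = trace (E ** mat 1) * trace (E ** outer c a) / ?n" for E
    unfolding axis
    by (simp add: trace_mult_outer sum_distrib_left sum_distrib_right sum_divide_distrib ac_simps)
  then have "(\<Sum>E\<in>frame p. \<Sum>k\<in>UNIV. trace (E ** outer (axis k 1) a) * (c $ k / ?n * trace E))
      = (\<Sum>E\<in>frame p. trace (E ** mat 1) * trace (E ** outer c a)) / ?n"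
    by (simp add: sum_divide_distrib)
  also have "\<dots> = 0"
    using ac by (subst sum_frame_trace_mult_trace [OF p]) (simp_all add: trace_outer mult.commute)
  finally show ?thesis
    using 1 by (simp add: split distrib_left sum.distrib)
qed

text \<open>Differentiating \<open>c a\<close> along \<open>p ** E\<close> varies the row, giving
  the terms \<open>a E E c\<close>, and the column, giving second derivatives of the quotient. Both
  sums over the frame vanish because \<open>a c = 0\<close>.\<close>

lemma tension_field_quotient:
  assumes M: "M \<subseteq> Q_domain q" and p: "p \<in> M"
  shows "tension_field M left_invariant_metric (\<lambda>z. Q q \<alpha> z / Q q \<beta> z) p = 0"
proof -
  let ?N = "\<lambda>x. outer (quotient_column q \<alpha> \<beta> x) (Q_row q x)"
  define a c b where "a = Q_row q p" and "c = quotient_column q \<alpha> \<beta> p" and "b = Q q \<beta> p"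
  have b: "b \<noteq> 0"
    using M p unfolding b_def Q_domain_def by blast
  have ac: "(\<Sum>k\<in>UNIV. a $ k * c $ k) = 0"
    using Q_row_quotient_column b unfolding a_def b_def c_def by blast
  have "trace (E ** dir_deriv M ?N p (p ** E)) =
      (\<Sum>k\<in>UNIV. trace (E ** outer (axis k 1) a) * trace (E ** outer c (axis k 1)))
      - 2 / b * (trace (E ** outer (axis \<beta> 1) a) * trace (E ** outer c a))" if "E \<in> L" for E
  proof -
    define d where "d = Q_row q (p ** E)"
    define c' where "c' = quotient_column_derivative q \<alpha> \<beta> p (p ** E)"
    have d: "d $ k = (\<Sum>j\<in>UNIV. a $ j * E $ j $ k)" for k
      by (simp add: d_def a_def Q_row_def Q_mult)
    have dk: "trace (E ** outer (axis k 1) a) = d $ k" for k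
      by (simp add: trace_mult_outer d [symmetric] sum_mult_axis)
    have "trace (E ** outer c d) = (\<Sum>l\<in>UNIV. \<Sum>k\<in>UNIV. d $ k * (E $ k $ l * c $ l))"
      by (simp add: trace_mult_outer sum_distrib_right mult.assoc)
    also have "\<dots> = (\<Sum>k\<in>UNIV. \<Sum>l\<in>UNIV. d $ k * (E $ k $ l * c $ l))"
      by (rule sum.swap)
    also have "\<dots> = (\<Sum>k\<in>UNIV. d $ k * trace (E ** outer c (axis k 1)))"
      by (simp add: trace_mult_outer sum_axis_mult sum_distrib_left)
    finally have 1: "trace (E ** outer c d) = (\<Sum>k\<in>UNIV. d $ k * trace (E ** outer c (axis k 1)))" .
    have "trace (E ** outer c' a) = (\<Sum>k\<in>UNIV. d $ k * c' $ k)"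
      by (simp add: trace_mult_outer d)
    \<comment> \<open>For \<open>h = a\<^sub>\<alpha> / a\<^sub>\<beta>\<close> differentiating
      \<open>a\<^sub>\<beta> h = a\<^sub>\<alpha>\<close> twice along \<open>d\<close> gives
      \<open>b h'' + 2 d\<^sub>\<beta> h' = 0\<close>, so the second derivative is a multiple of the
      first.\<close>
    also have "\<dots> = - (2 / b * (d $ \<beta> * (d $ \<alpha> / b - d $ \<beta> * Q q \<alpha> p / b\<^sup>2)))"
      using b unfolding c'_def sum_mult_quotient_column_derivative
      by (simp add: d_def Q_row_def b_def field_simps power2_eq_square power3_eq_cube)
    also have "d $ \<alpha> / b - d $ \<beta> * Q q \<alpha> p / b\<^sup>2 = trace (E ** outer c a)"
      using sum_mult_quotient_column [of d] by (simp add: trace_mult_outer d [symmetric] c_def b_def)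
    finally have 2: "trace (E ** outer c' a) = - (2 / b * (d $ \<beta> * trace (E ** outer c a)))" .
    have "p ** E \<in> tangent_space M p"
      using that tangent_space [OF p] by blast
    then have "dir_deriv M ?N p (p ** E) = outer c d + outer c' a"
      using dir_deriv_eq [OF p _ outer_quotient_column_has_derivative [OF b [unfolded b_def]] refl]
      unfolding c_def d_def c'_def a_def by blast
    then show ?thesis
      by (simp add: matrix_mult_linear_simps trace_linear_simps 1 2 dk)
  qed
  then have "tension_field M left_invariant_metric (\<lambda>z. Q q \<alpha> z / Q q \<beta> z) p =
      (\<Sum>E\<in>frame p. (\<Sum>k\<in>UNIV. trace (E ** outer (axis k 1) a) * trace (E ** outer c (axis k 1)))
        - 2 / b * (trace (E ** outer (axis \<beta> 1) a) * trace (E ** outer c a)))"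
    unfolding tension_field_eq [OF differential_matrix_quotient [OF M] p]
    using span_frame [OF p] span_base by (intro sum.cong) blast+
  also have "\<dots> = - (2 / b * (\<Sum>E\<in>frame p. trace (E ** outer (axis \<beta> 1) a) * trace (E ** outer c a)))"
    by (simp add: sum_subtractf sum_frame_trace_square [OF p ac] sum_distrib_left)
  \<comment> \<open>The Casimir identity yields the trace of a product of rank-one matrices that has
    \<open>a c\<close> as a factor.\<close>
  also have "\<dots> = 0"
    using ac by (subst sum_frame_trace_mult_trace [OF p])
      (simp_all add: trace_outer trace_outer_mult_outer mult.commute)
  finally show ?thesis .
qed

lemma orthogonal_harmonic_family_Q:
  assumes M: "M \<subseteq> Q_domain q"
  shows "orthogonal_harmonic_family M left_invariant_metric (Q_family q)"
proof -
  have "conformality M left_invariant_metric (\<lambda>z. Q q \<alpha> z / Q q \<beta> z) (\<lambda>z. Q q \<gamma> z / Q q \<delta> z) p = 0"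
    if p: "p \<in> M" for \<alpha> \<beta> \<gamma> \<delta> p
  proof -
    \<comment> \<open>Both differential matrices share the row \<open>a\<close>, so the trace of
      their product contains \<open>a\<close> times the column of the second quotient, which is
      0.\<close>
    have "Q q \<delta> p \<noteq> 0"
      using M p unfolding Q_domain_def by blast
    then show ?thesis
      by (simp add: conformality_eq [OF differential_matrix_quotient [OF M]
            differential_matrix_quotient [OF M] p] trace_outer_mult_outer Q_row_quotient_column)
  qed
  then show ?thesis
    unfolding orthogonal_harmonic_family_def Q_family_def
    using tension_field_quotient [OF M] twice_differentiable [OF differential_matrix_quotient [OF M]]
    by auto
qed

end

section \<open>Passage to the open subsets of both groups\<close>

lemma open_Q_nonzero: "open {z. \<forall>\<alpha>. Q q \<alpha> z \<noteq> 0}"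
proof -
  have "open (\<Inter>\<alpha>. {z. Q q \<alpha> z \<noteq> 0})"
    by (intro open_INT finite ballI open_Collect_neq continuous_on_const
        bounded_linear.continuous_on [OF bounded_linear_Q] continuous_on_id)
  moreover have "(\<Inter>\<alpha>. {z. Q q \<alpha> z \<noteq> 0}) = {z. \<forall>\<alpha>. Q q \<alpha> z \<noteq> 0}"
    by auto
  ultimately show ?thesis
    by simp
qed

theorem proposition10p4:
  fixes q :: "complex^'n"
  assumes "q \<noteq> 0"
  shows "openin (top_of_set unitary_group) (Q_domain q)
    \<and> orthogonal_harmonic_family (Q_domain q) left_invariant_metric (Q_family q)
    \<and> orthogonal_harmonic_family (Q_domain q \<inter> special_unitary_group) left_invariant_metric (Q_family q)"
proof -
  let ?T = "{z. \<forall>\<alpha>. Q q \<alpha> z \<noteq> 0}"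
  \<comment> \<open>Each domain is its group cut by the same open set, so it inherits the tangent
    spaces of the group.\<close>
  have U: "Q_domain q = unitary_group \<inter> ?T"
    and SU: "Q_domain q \<inter> special_unitary_group = special_unitary_group \<inter> ?T"
    unfolding Q_domain_def special_unitary_group_def by auto
  interpret U: unitary_submanifold "Q_domain q" skew_hermitian
    by unfold_locales
      (auto simp: U tangent_space_Int_open [OF open_Q_nonzero] tangent_space_unitary_group
        subspace_skew_hermitian traceless_skew_hermitian_def)
  interpret SU: unitary_submanifold "Q_domain q \<inter> special_unitary_group" traceless_skew_hermitian
  proof
    show "Q_domain q \<inter> special_unitary_group \<subseteq> unitary_group"
      by (auto simp: special_unitary_group_def)
    show "tangent_space (Q_domain q \<inter> special_unitary_group) p = (**) p ` traceless_skew_hermitian"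
      if "p \<in> Q_domain q \<inter> special_unitary_group" for p
      using that unfolding SU
      by (simp add: tangent_space_Int_open [OF open_Q_nonzero] tangent_space_special_unitary_group)
  qed (use subspace_traceless_skew_hermitian in \<open>auto simp: traceless_skew_hermitian_def\<close>)
  have "openin (top_of_set unitary_group) (Q_domain q)"
    unfolding U by (intro openin_open_Int open_Q_nonzero)
  moreover have "orthogonal_harmonic_family (Q_domain q) left_invariant_metric (Q_family q)"
    by (rule U.orthogonal_harmonic_family_Q) simp
  moreover have "orthogonal_harmonic_family (Q_domain q \<inter> special_unitary_group)
      left_invariant_metric (Q_family q)"
    by (rule SU.orthogonal_harmonic_family_Q) simp
  ultimately show ?thesis
    by blast
qed

end
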